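(* Let $F$ be a real ternary cubic form on $\mathbf R^3$ with Hessian $H$ and basic degree $4$ (Aronhold) invariant $S$. Let $W\subset\mathbf R^3$ be the index cone of $F$ and $W_1=\{D\in W:F(D)=1\}$, with its natural Riemannian metric. Then for any point $D\in W$, the curvature $R$ of the surface $W_1$ at the corresponding point $D/F(D)^{1/3}$ is $$R=-\frac94+\frac{6^6\,S\,F(D)^2}{4\,H(D)^2}.$$
   Context: Write $D\cup L\cup M$ for the symmetric trilinear form obtained by polarising $F$, normalised so that $D\cup D\cup D=F(D)$. The index cone $W$ is the set of $D\in\mathbf R^3$ with $F(D)>0$ such that the quadratic form $L\mapsto D\cup L\cup L$ on $\mathbf R^3$ has signature $(1,2)$ (one positive, two negative). $W_1$ is a smooth surface with tangent space $\{L: D\cup D\cup L=0\}$ at $D$, and Riemannian metric $(L_1,L_2)\mapsto-D\cup L_1\cup L_2$; "curvature" means its sectional (Gaussian) curvature. In coordinates $x_0,x_1,x_2$ on $\mathbf R^3$, $H=\det\big(\partial^2F/\partial x_i\partial x_j\big)$. The invariant $S$ is the $SL(3)$-invariant of degree $4$ in the coefficients of ternary cubics (unique up to scale), normalised so that $S(x_0x_1x_2)=1/6^4$. Explicitly, for $$F=a x^3+b y^3+c z^3+3a_2x^2y+3a_3x^2z+3b_1xy^2+3b_3y^2z+3c_1xz^2+3c_2yz^2+6m\,xyz,$$ one has $$-S=abcm-(bca_2a_3+cab_1b_3+abc_1c_2)-m(ab_3c_2+bc_1a_3+ca_2b_1)+(ab_1c_2^2+ac_1b_3^2+ba_2c_1^2+bc_2a_3^2+cb_3a_2^2+ca_3b_1^2)-m^4+2m^2(b_1c_1+c_2a_2+a_3b_3)-3m(a_2b_3c_1+a_3b_1c_2)-(b_1^2c_1^2+c_2^2a_2^2+a_3^2b_3^2)+(c_2a_2a_3b_3+a_3b_3b_1c_1+b_1c_1c_2a_2).$$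 In this normalisation, for $F=Ax_0^3-3x_0(px_1^2+2qx_1x_2+rx_2^2)+a_{30}x_1^3+3a_{21}x_1^2x_2+3a_{12}x_1x_2^2+a_{03}x_2^3$ one has $S=(pr-q^2)^2+A\big(p(a_{12}^2-a_{21}a_{03})+q(a_{30}a_{03}-a_{21}a_{12})+r(a_{21}^2-a_{30}a_{12})\big)$. *)

theory Defs
  imports "HOL-Analysis.Analysis"
begin

section \<open>Ternary cubic forms\<close>

text \<open>
  The fields of \<open>Cubic a b c a2 a3 b1 b3 c1 c2 m\<close> are the classical coefficients: multinomial
  factors are split off, so \<open>a2\<close> is one third of the coefficient of \<open>x\<^sup>2 y\<close>, and \<open>m\<close> is one
  sixth of the coefficient of \<open>x y z\<close>.
\<close>

datatype ternary_cubic = Cubic real real real real real real real real real real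

fun cubic_form :: "ternary_cubic \<Rightarrow> real^3 \<Rightarrow> real" where
  "cubic_form (Cubic a b c a2 a3 b1 b3 c1 c2 m) v =
     (let x = v $ 1; y = v $ 2; z = v $ 3 in
        a * x^3 + b * y^3 + c * z^3
      + 3 * a2 * x^2 * y + 3 * a3 * x^2 * z
      + 3 * b1 * x * y^2 + 3 * b3 * y^2 * z
      + 3 * c1 * x * z^2 + 3 * c2 * y * z^2
      + 6 * m * x * y * z)"

text \<open>The normalisation is such that \<open>x y z\<close>, that is \<open>m = 1/6\<close>, has invariant \<open>1/6^4\<close>.\<close>

fun aronhold_S :: "ternary_cubic \<Rightarrow> real" where
  "aronhold_S (Cubic a b c a2 a3 b1 b3 c1 c2 m) =
     - (a*b*c*m
        - (b*c*a2*a3 + c*a*b1*b3 + a*b*c1*c2)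
        - m * (a*b3*c2 + b*c1*a3 + c*a2*b1)
        + (a*b1*c2^2 + a*c1*b3^2 + b*a2*c1^2 + b*c2*a3^2 + c*b3*a2^2 + c*a3*b1^2)
        - m^4
        + 2 * m^2 * (b1*c1 + c2*a2 + a3*b3)
        - 3 * m * (a2*b3*c1 + a3*b1*c2)
        - (b1^2*c1^2 + c2^2*a2^2 + a3^2*b3^2)
        + (c2*a2*a3*b3 + a3*b3*b1*c1 + b1*c1*c2*a2))"

text \<open>
  Polarisation of a cubic form: the symmetric trilinear form whose value on the
  diagonal is \<open>f\<close>.
\<close>

definition polar3 :: "('a::real_vector \<Rightarrow> real) \<Rightarrow> 'a \<Rightarrow> 'a \<Rightarrow> 'a \<Rightarrow> real" where
  "polar3 f D L M =
     (f (D + L + M) - f (D + L) - f (D + M) - f (L + M) + f D + f L + f M) / 6"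


section \<open>Partial derivatives and smoothness\<close>

definition pd :: "'n::finite \<Rightarrow> (real^'n \<Rightarrow> 'b::real_normed_vector) \<Rightarrow> real^'n \<Rightarrow> 'b" where
  "pd i f x = frechet_derivative f (at x) (axis i 1)"

definition hessian_det :: "(real^'n \<Rightarrow> real) \<Rightarrow> real^'n \<Rightarrow> real" where
  "hessian_det f x = det (\<chi> i j. pd i (pd j f) x)"

text \<open>\<open>C_k_on k f U\<close> is meant for open \<open>U\<close>, the derivatives being taken at \<open>at x\<close>.\<close>

primrec C_k_on ::
  "nat \<Rightarrow> ('a::real_normed_vector \<Rightarrow> 'b::real_normed_vector) \<Rightarrow> 'a set \<Rightarrow> bool" where
  "C_k_on 0 f U \<longleftrightarrow> continuous_on U f"
| "C_k_on (Suc k) f U \<longleftrightarrow>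
     f differentiable_on U \<and> (\<forall>v. C_k_on k (\<lambda>x. frechet_derivative f (at x) v) U)"

definition smooth_on ::
  "('a::real_normed_vector \<Rightarrow> 'b::real_normed_vector) \<Rightarrow> 'a set \<Rightarrow> bool" where
  "smooth_on f U \<longleftrightarrow> (\<forall>k. C_k_on k f U)"


section \<open>Index cone\<close>

text \<open>
  A symmetric bilinear form \<open>B\<close> has signature \<open>(p, q)\<close> if some \<open>B\<close>-orthogonal basis has
  exactly \<open>p\<close> positive and \<open>q\<close> negative vectors.
\<close>

definition has_signature :: "('a::euclidean_space \<Rightarrow> 'a \<Rightarrow> real) \<Rightarrow> nat \<Rightarrow> nat \<Rightarrow> bool" where
  "has_signature B p q \<longleftrightarrow>
     (\<exists>E. independent E \<and> span E = UNIV \<and> pairwise (\<lambda>u v. B u v = 0) E \<and>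
          card {e \<in> E. B e e > 0} = p \<and> card {e \<in> E. B e e < 0} = q)"

definition index_cone :: "(real^3 \<Rightarrow> real) \<Rightarrow> (real^3) set" where
  "index_cone f = {D. f D > 0 \<and> has_signature (polar3 f D) 1 2}"

definition index_level :: "(real^3 \<Rightarrow> real) \<Rightarrow> (real^3) set" where
  "index_level f = {D \<in> index_cone f. f D = 1}"

definition index_metric :: "(real^3 \<Rightarrow> real) \<Rightarrow> real^3 \<Rightarrow> real^3 \<Rightarrow> real^3 \<Rightarrow> real" where
  "index_metric f D L1 L2 = - polar3 f D L1 L2"


section \<open>Curvature of a metric in coordinates\<close>

text \<open>
  Below \<open>g\<close> is the Gram matrix of a metric in a coordinate patch. \<open>christoffel g k i j\<close> is
  \<open>\<Gamma>\<^sup>k\<^sub>i\<^sub>j\<close>, and \<open>riemann g l k i j\<close> is the coefficient of \<open>\<partial>\<^sub>l\<close> in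
  \<open>R(\<partial>\<^sub>i, \<partial>\<^sub>j)\<partial>\<^sub>k = \<nabla>\<^sub>i\<nabla>\<^sub>j\<partial>\<^sub>k - \<nabla>\<^sub>j\<nabla>\<^sub>i\<partial>\<^sub>k\<close>.
\<close>

definition christoffel ::
  "(real^'n \<Rightarrow> real^'n^'n) \<Rightarrow> 'n \<Rightarrow> 'n \<Rightarrow> 'n \<Rightarrow> real^'n \<Rightarrow> real" where
  "christoffel g k i j x =
     (\<Sum>l\<in>UNIV. matrix_inv (g x) $ k $ l *
        (pd i (\<lambda>y. g y $ j $ l) x + pd j (\<lambda>y. g y $ i $ l) x - pd l (\<lambda>y. g y $ i $ j) x)) / 2"

definition riemann ::
  "(real^'n \<Rightarrow> real^'n^'n) \<Rightarrow> 'n \<Rightarrow> 'n \<Rightarrow> 'n \<Rightarrow> 'n \<Rightarrow> real^'n \<Rightarrow> real" where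
  "riemann g l k i j x =
     pd i (christoffel g l j k) x - pd j (christoffel g l i k) x
     + (\<Sum>m\<in>UNIV. christoffel g l i m x * christoffel g m j k x
                 - christoffel g l j m x * christoffel g m i k x)"

text \<open>
  The sectional curvature
  \<open>\<langle>R(\<partial>\<^sub>1, \<partial>\<^sub>2)\<partial>\<^sub>2, \<partial>\<^sub>1\<rangle> / (g\<^sub>1\<^sub>1 g\<^sub>2\<^sub>2 - g\<^sub>1\<^sub>2\<^sup>2)\<close>
  of the only tangent plane, positive for the round sphere.
\<close>

definition gauss_curvature :: "(real^2 \<Rightarrow> real^2^2) \<Rightarrow> real^2 \<Rightarrow> real" where
  "gauss_curvature g x = (\<Sum>l\<in>UNIV. g x $ 1 $ l * riemann g l 2 1 2 x) / det (g x)"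


section \<open>Curvature of a surface\<close>

definition surface_chart ::
  "(real^'n) set \<Rightarrow> (real^2) set \<Rightarrow> (real^2 \<Rightarrow> real^'n) \<Rightarrow> bool" where
  "surface_chart S U \<phi> \<longleftrightarrow>
     open U \<and> smooth_on \<phi> U \<and> (\<forall>x\<in>U. inj (frechet_derivative \<phi> (at x))) \<and>
     openin (top_of_set S) (\<phi> ` U) \<and> (\<exists>\<psi>. homeomorphism U (\<phi> ` U) \<phi> \<psi>)"

definition pullback_metric ::
  "(real^'n \<Rightarrow> real^'n \<Rightarrow> real^'n \<Rightarrow> real) \<Rightarrow> (real^2 \<Rightarrow> real^'n) \<Rightarrow> real^2 \<Rightarrow> real^2^2" where
  "pullback_metric g \<phi> x = (\<chi> i j. g (\<phi> x) (pd i \<phi> x) (pd j \<phi> x))"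

text \<open>
  The subset \<open>S\<close> is a smooth surface near \<open>p\<close>, and its metric \<open>g\<close> (applied at each point to
  tangent vectors of \<open>S\<close>) has Gaussian curvature \<open>R\<close> at \<open>p\<close>, whichever chart around \<open>p\<close> is
  used to compute it. The first conjunct prevents this from holding vacuously.
\<close>

definition has_gauss_curvature_at ::
  "(real^'n) set \<Rightarrow> (real^'n \<Rightarrow> real^'n \<Rightarrow> real^'n \<Rightarrow> real) \<Rightarrow> real^'n \<Rightarrow> real \<Rightarrow> bool" where
  "has_gauss_curvature_at S g p R \<longleftrightarrow>
     (\<exists>U \<phi>. surface_chart S U \<phi> \<and> p \<in> \<phi> ` U) \<and>
     (\<forall>U \<phi> x. surface_chart S U \<phi> \<and> x \<in> U \<and> \<phi> x = p \<longrightarrow>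
        gauss_curvature (pullback_metric g \<phi>) x = R)"

end

theory Submission
  imports Defs
begin

text \<open>
  Let \<open>T\<close> be the polarisation of the cubic form \<open>F\<close>, and let \<open>\<phi>\<close> be a chart of the surface \<open>F = 1\<close>, with
  first and second partial derivatives \<open>\<phi>\<^sub>i\<close> and \<open>\<phi>\<^sub>i\<^sub>j\<close>. Differentiating \<open>T(\<phi>, \<phi>, \<phi>) = 1\<close> once and
  twice gives \<open>T(\<phi>, \<phi>, \<phi>\<^sub>i) = 0\<close> and \<open>T(\<phi>, \<phi>, \<phi>\<^sub>i\<^sub>j) = 2 g\<^sub>i\<^sub>j\<close>, where \<open>g\<^sub>i\<^sub>j = - T(\<phi>, \<phi>\<^sub>i, \<phi>\<^sub>j)\<close> is the
  metric. So \<open>\<phi>, \<phi>\<^sub>1, \<phi>\<^sub>2\<close> is a basis of the ambient space, and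
  \<open>\<phi>\<^sub>i\<^sub>j = 2 g\<^sub>i\<^sub>j \<phi> + A\<^sup>1\<^sub>i\<^sub>j \<phi>\<^sub>1 + A\<^sup>2\<^sub>i\<^sub>j \<phi>\<^sub>2\<close> for a connection \<open>A\<close>. Put \<open>C\<^sub>i\<^sub>j\<^sub>l = T(\<phi>\<^sub>i, \<phi>\<^sub>j, \<phi>\<^sub>l)\<close>. Differentiating the
  metric shows that \<open>A\<close> differs from the Levi-Civita connection by half of \<open>C\<close>, with one index raised.

  The curvature is computed from the Christoffel symbols of the first kind
  (\<open>gauss_curvature_lower\<close>). The third derivatives of \<open>\<phi>\<close> cancel because mixed partial derivatives
  commute (\<open>pd_commute\<close>), the Christoffel symbols cancel against those contained in \<open>A\<close>, and what is
  left is \<open>- 2\<close> plus a term quadratic in \<open>C\<close>. This term is \<open>- 1/4\<close> plus the Aronhold invariant of \<open>F\<close>,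
  written in the basis \<open>\<phi>, \<phi>\<^sub>1, \<phi>\<^sub>2\<close>, divided by \<open>4 (det g)\<^sup>2\<close> (\<open>chart_gauss_curvature\<close>): in
  this basis \<open>F\<close> has the adapted shape \<open>x\<^sub>0\<^sup>3 - 3 x\<^sub>0 g(x\<^sub>1, x\<^sub>2) + C(x\<^sub>1, x\<^sub>2)\<close>.

  A change of basis by \<open>M\<close> multiplies \<open>S\<close> by \<open>(det M)\<^sup>4\<close> (\<open>aronhold_S_subst\<close>) and the determinant of
  the quadratic form \<open>T(\<phi>, \<cdot>, \<cdot>)\<close>, which is the Hessian up to the factor \<open>6\<^sup>3\<close>, by \<open>(det M)\<^sup>2\<close>
  (\<open>det_metric_eq_hessian\<close>). So \<open>S / (det g)\<^sup>2\<close> in the basis \<open>\<phi>, \<phi>\<^sub>1, \<phi>\<^sub>2\<close> equals \<open>6\<^sup>6 S / H\<^sup>2\<close> in the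
  standard coordinates, and homogeneity of \<open>F\<close> and \<open>H\<close> carries the formula to the whole cone.

  Finally the surface has charts at all: radial projection of an affine plane to the surface \<open>F = 1\<close>
  (\<open>index_level_has_chart\<close>). This uses that the index cone is open (\<open>open_index_cone\<close>).
\<close>

section \<open>Partial derivatives\<close>

lemma pd_eqI: "(f has_derivative f') (at x) \<Longrightarrow> pd i f x = f' (axis i 1)"
  unfolding pd_def using frechet_derivative_at by metis

lemma pd_cong_open:
  assumes "open U" "x \<in> U" "\<And>y. y \<in> U \<Longrightarrow> f y = g y" "f differentiable at x"
  shows "pd i f x = pd i g x"
  unfolding pd_def using frechet_derivative_transform_within_open[OF assms(4,1,2,3)] by simp

lemma differentiable_transform_open:
  assumes "open U" "x \<in> U" "\<And>y. y \<in> U \<Longrightarrow> f y = g y" "f differentiable at x"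
  shows "g differentiable at x"
  using has_derivative_transform_within_open[of f _ x UNIV U g] assms
  unfolding differentiable_def by blast

lemma pd_mult:
  fixes f g :: "real^'n \<Rightarrow> real"
  assumes "f differentiable at x" "g differentiable at x"
  shows "pd i (\<lambda>y. f y * g y) x = pd i f x * g x + f x * pd i g x"
  using pd_eqI[OF has_derivative_mult[OF assms[unfolded frechet_derivative_works]]]
  by (simp add: pd_def)

lemma pd_add:
  assumes "f differentiable at x" "g differentiable at x"
  shows "pd i (\<lambda>y. f y + g y) x = pd i f x + pd i g x"
  using pd_eqI[OF has_derivative_add[OF assms[unfolded frechet_derivative_works]]]
  by (simp add: pd_def)

lemma pd_const: "pd i (\<lambda>y. c) x = 0"
  by (simp add: pd_def)

lemma pd_cmult:
  fixes f :: "real^'n \<Rightarrow> real"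
  assumes "f differentiable at x"
  shows "pd i (\<lambda>y. c * f y) x = c * pd i f x"
  using pd_mult[OF differentiable_const assms, of i c] by (simp add: pd_const)

text \<open>
  Two applications of the mean value theorem, first along \<open>u\<close> to the difference of \<open>f\<close> in direction \<open>v\<close>,
  then along \<open>v\<close> to the derivative of \<open>f\<close> in direction \<open>u\<close>. The left-hand side is symmetric in \<open>u\<close>
  and \<open>v\<close>, whereas the order of differentiation on the right-hand side is not: this is the source of
  the symmetry of second derivatives.
\<close>

lemma mean_value_second_difference:
  fixes f :: "'a::real_normed_vector \<Rightarrow> real"
  assumes t: "0 < t"
    and U: "\<And>s r. 0 \<le> s \<Longrightarrow> s \<le> t \<Longrightarrow> 0 \<le> r \<Longrightarrow> r \<le> t \<Longrightarrow> x + s *\<^sub>R u + r *\<^sub>R v \<in> U"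
    and f': "\<And>y. y \<in> U \<Longrightarrow> (f has_derivative f' y) (at y)"
    and f'': "\<And>y. y \<in> U \<Longrightarrow> ((\<lambda>y. f' y u) has_derivative f'' y) (at y)"
  shows "\<exists>s r. 0 < s \<and> s < t \<and> 0 < r \<and> r < t \<and>
    f (x + t *\<^sub>R u + t *\<^sub>R v) - f (x + t *\<^sub>R u) - f (x + t *\<^sub>R v) + f x
      = t\<^sup>2 * f'' (x + s *\<^sub>R u + r *\<^sub>R v) v"
proof -
  define g where "g s = f (x + s *\<^sub>R u + t *\<^sub>R v) - f (x + s *\<^sub>R u + 0 *\<^sub>R v)" for s
  have g': "(g has_real_derivative
      f' (x + s *\<^sub>R u + t *\<^sub>R v) u - f' (x + s *\<^sub>R u + 0 *\<^sub>R v) u) (at s)"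
    if "0 \<le> s" "s \<le> t" for s
  proof -
    have "((\<lambda>s. f (x + s *\<^sub>R u + r *\<^sub>R v)) has_derivative
        (\<lambda>h. f' (x + s *\<^sub>R u + r *\<^sub>R v) (h *\<^sub>R u))) (at s)" if "0 \<le> r" "r \<le> t" for r
    proof -
      have "((\<lambda>s. x + s *\<^sub>R u + r *\<^sub>R v) has_derivative (\<lambda>h. h *\<^sub>R u)) (at s)"
        by (auto intro!: derivative_eq_intros)
      then show ?thesis
        using has_derivative_compose f'[OF U] \<open>0 \<le> s\<close> \<open>s \<le> t\<close> that by blast
    qed
    note d = this[of t] this[of 0]
    have l: "f' (x + s *\<^sub>R u + r *\<^sub>R v) (h *\<^sub>R u) = h * f' (x + s *\<^sub>R u + r *\<^sub>R v) u"
      if "0 \<le> r" "r \<le> t" for r h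
      using has_derivative_linear[OF f'[OF U]] \<open>0 \<le> s\<close> \<open>s \<le> t\<close> that
      by (simp add: linear_scale)
    show ?thesis
      unfolding g_def has_field_derivative_def
      by (rule has_derivative_eq_rhs, rule has_derivative_diff[OF d])
        (use t l[of t] l[of 0] in \<open>auto simp: fun_eq_iff right_diff_distrib mult.commute\<close>)
  qed
  obtain s where s: "0 < s" "s < t"
    and gs: "g t - g 0 = t * (f' (x + s *\<^sub>R u + t *\<^sub>R v) u - f' (x + s *\<^sub>R u + 0 *\<^sub>R v) u)"
    using MVT2[OF t g'] by auto
  have h': "((\<lambda>r. f' (x + s *\<^sub>R u + r *\<^sub>R v) u) has_real_derivative
      f'' (x + s *\<^sub>R u + r *\<^sub>R v) v) (at r)" if "0 \<le> r" "r \<le> t" for r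
  proof -
    have d: "((\<lambda>r. f' (x + s *\<^sub>R u + r *\<^sub>R v) u) has_derivative
        (\<lambda>h. f'' (x + s *\<^sub>R u + r *\<^sub>R v) (h *\<^sub>R v))) (at r)"
    proof -
      have "((\<lambda>r. x + s *\<^sub>R u + r *\<^sub>R v) has_derivative (\<lambda>h. h *\<^sub>R v)) (at r)"
        by (auto intro!: derivative_eq_intros)
      then show ?thesis
        using has_derivative_compose f''[OF U[of s r]] s that by fastforce
    qed
    have l: "linear (f'' (x + s *\<^sub>R u + r *\<^sub>R v))"
      using f''[OF U] s that has_derivative_linear by (meson less_imp_le)
    show ?thesis
      unfolding has_field_derivative_def
      by (rule has_derivative_eq_rhs[OF d]) (auto simp: linear_scale[OF l] mult.commute)
  qed
  obtain r where r: "0 < r" "r < t"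
    and hr: "f' (x + s *\<^sub>R u + t *\<^sub>R v) u - f' (x + s *\<^sub>R u + 0 *\<^sub>R v) u
      = t * f'' (x + s *\<^sub>R u + r *\<^sub>R v) v"
    using MVT2[OF t h'] by auto
  show ?thesis
    by (rule exI[of _ s], rule exI[of _ r])
      (use s r gs hr in \<open>simp add: g_def power2_eq_square\<close>)
qed

text \<open>
  Both iterated derivatives, at points near \<open>x\<close>, equal the same second difference divided by \<open>t\<^sup>2\<close>.
  As \<open>t\<close> tends to 0 these points tend to \<open>x\<close>, where both derivatives are continuous.
\<close>

lemma second_derivative_symmetric_real:
  fixes f :: "'a::real_normed_vector \<Rightarrow> real"
  assumes U: "open U" "x \<in> U"
    and f': "\<And>y. y \<in> U \<Longrightarrow> (f has_derivative f' y) (at y)"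
    and fu: "\<And>y. y \<in> U \<Longrightarrow> ((\<lambda>y. f' y u) has_derivative fu y) (at y)"
    and fv: "\<And>y. y \<in> U \<Longrightarrow> ((\<lambda>y. f' y v) has_derivative fv y) (at y)"
    and cont: "continuous_on U (\<lambda>y. fu y v)" "continuous_on U (\<lambda>y. fv y u)"
  shows "fu x v = fv x u"
proof (rule ccontr)
  assume ne: "fu x v \<noteq> fv x u"
  define e where "e = \<bar>fu x v - fv x u\<bar> / 2"
  have e: "e > 0" using ne by (simp add: e_def)
  obtain d0 where d0: "d0 > 0" "ball x d0 \<subseteq> U"
    using U open_contains_ball by blast
  have at: "continuous (at x) (\<lambda>y. fu y v)" "continuous (at x) (\<lambda>y. fv y u)"
    using cont U by (auto simp: continuous_on_eq_continuous_at)
  obtain d1 where d1: "d1 > 0" "\<And>y. dist y x < d1 \<Longrightarrow> dist (fu y v) (fu x v) < e"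
    using at(1) e unfolding continuous_at_eps_delta by blast
  obtain d2 where d2: "d2 > 0" "\<And>y. dist y x < d2 \<Longrightarrow> dist (fv y u) (fv x u) < e"
    using at(2) e unfolding continuous_at_eps_delta by blast
  define d where "d = min d0 (min d1 d2)"
  have d: "d > 0" "d \<le> d0" "d \<le> d1" "d \<le> d2" using d0 d1 d2 by (auto simp: d_def)
  \<comment> \<open>the corners of the parallelogram with sides \<open>t u\<close> and \<open>t v\<close> then stay within distance \<open>d / 2\<close> of \<open>x\<close>\<close>
  define t where "t = d / (2 * (norm u + norm v + 1))"
  have nn: "norm u + norm v + 1 > 0" by (smt (verit) norm_ge_zero)
  have t: "t > 0" using d nn by (simp add: t_def)
  have near: "dist (x + s *\<^sub>R u + r *\<^sub>R v) x < d"
    if "0 \<le> s" "s \<le> t" "0 \<le> r" "r \<le> t" for s r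
  proof -
    have "dist (x + s *\<^sub>R u + r *\<^sub>R v) x \<le> s * norm u + r * norm v"
      using norm_triangle_ineq[of "s *\<^sub>R u" "r *\<^sub>R v"] that by (simp add: dist_norm add.assoc)
    also have "\<dots> \<le> t * norm u + t * norm v"
      using that by (intro add_mono mult_right_mono) auto
    also have "\<dots> \<le> t * (norm u + norm v + 1)" using t by (simp add: algebra_simps)
    also have "\<dots> = d / 2" using nn by (simp add: t_def divide_simps)
    finally show ?thesis using d by simp
  qed
  have inU: "x + s *\<^sub>R u + r *\<^sub>R v \<in> U" if "0 \<le> s" "s \<le> t" "0 \<le> r" "r \<le> t" for s r
    using near[OF that] d(2) d0(2) by (auto simp: dist_commute)
  have inU': "x + s *\<^sub>R v + r *\<^sub>R u \<in> U" if "0 \<le> s" "s \<le> t" "0 \<le> r" "r \<le> t" for s r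
    using inU[of r s] that by (simp add: add_ac)
  obtain s r where sr: "0 < s" "s < t" "0 < r" "r < t"
    and eq1: "f (x + t *\<^sub>R u + t *\<^sub>R v) - f (x + t *\<^sub>R u) - f (x + t *\<^sub>R v) + f x
      = t\<^sup>2 * fu (x + s *\<^sub>R u + r *\<^sub>R v) v"
    using mean_value_second_difference[OF t inU f' fu] by blast
  obtain s' r' where sr': "0 < s'" "s' < t" "0 < r'" "r' < t"
    and eq2: "f (x + t *\<^sub>R v + t *\<^sub>R u) - f (x + t *\<^sub>R v) - f (x + t *\<^sub>R u) + f x
      = t\<^sup>2 * fv (x + s' *\<^sub>R v + r' *\<^sub>R u) u"
    using mean_value_second_difference[OF t inU' f' fv] by blast
  have "t\<^sup>2 * fu (x + s *\<^sub>R u + r *\<^sub>R v) v = t\<^sup>2 * fv (x + s' *\<^sub>R v + r' *\<^sub>R u) u"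
  proof -
    have "f (x + t *\<^sub>R v + t *\<^sub>R u) = f (x + t *\<^sub>R u + t *\<^sub>R v)" by (simp add: add_ac)
    then show ?thesis using eq1 eq2 by linarith
  qed
  then have eq: "fu (x + s *\<^sub>R u + r *\<^sub>R v) v = fv (x + r' *\<^sub>R u + s' *\<^sub>R v) u"
    using t by (simp add: add_ac)
  have "dist (fu (x + s *\<^sub>R u + r *\<^sub>R v) v) (fu x v) < e"
    using near[of s r] sr d by (intro d1) auto
  moreover have "dist (fv (x + r' *\<^sub>R u + s' *\<^sub>R v) u) (fv x u) < e"
    using near[of r' s'] sr' d by (intro d2) auto
  ultimately have "dist (fu x v) (fv x u) < 2 * e"
    using eq dist_triangle_half_r[of _ "fu x v" "2 * e"] by simp
  then show False by (simp add: e_def dist_real_def)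
qed

section \<open>Functions of class \<open>C\<^sup>k\<close>\<close>

lemma C_k_on_cong:
  assumes "open U" "\<And>x. x \<in> U \<Longrightarrow> f x = g x" "C_k_on k f U"
  shows "C_k_on k g U"
  using assms(2,3)
proof (induction k arbitrary: f g)
  case 0
  then show ?case using continuous_on_cong[of U U f g] by simp
next
  case (Suc k)
  have df: "f differentiable (at x)" if "x \<in> U" for x
    using Suc.prems(2) that \<open>open U\<close> by (simp add: differentiable_on_eq_differentiable_at)
  have dg: "(g has_derivative frechet_derivative f (at x)) (at x)" if "x \<in> U" for x
    using has_derivative_transform_within_open[of f _ x UNIV U g] \<open>open U\<close> that Suc.prems(1)
      df[OF that] frechet_derivative_works by blast
  have "g differentiable_on U"
    using dg \<open>open U\<close> differentiableI by (auto simp: differentiable_on_eq_differentiable_at)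
  moreover have "C_k_on k (\<lambda>x. frechet_derivative g (at x) v) U" for v
    by (rule Suc.IH[of "\<lambda>x. frechet_derivative f (at x) v"])
      (use Suc.prems frechet_derivative_at[OF dg] in auto)
  ultimately show ?case by simp
qed

text \<open>
  The definition refers to the derivative chosen by \<open>frechet_derivative\<close>. This rule accepts any
  explicitly known one.
\<close>

lemma C_k_on_SucI:
  assumes "open U" and d: "\<And>x. x \<in> U \<Longrightarrow> (f has_derivative f' x) (at x)"
    and "\<And>v. C_k_on k (\<lambda>x. f' x v) U"
  shows "C_k_on (Suc k) f U"
proof -
  have "C_k_on k (\<lambda>x. frechet_derivative f (at x) v) U" for v
    by (rule C_k_on_cong[OF \<open>open U\<close> _ assms(3)[of v]]) (use frechet_derivative_at[OF d] in auto)
  then show ?thesis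
    using d \<open>open U\<close> unfolding differentiable_def
    by (auto simp: differentiable_on_eq_differentiable_at differentiable_def)
qed

lemma C_k_on_Suc_derivative:
  assumes "C_k_on (Suc k) f U" "open U" "x \<in> U"
  shows "(f has_derivative frechet_derivative f (at x)) (at x)"
  using assms by (simp add: differentiable_on_eq_differentiable_at flip: frechet_derivative_works)

lemma C_k_on_SucD: "C_k_on (Suc k) f U \<Longrightarrow> C_k_on k f U"
proof (induction k arbitrary: f)
  case 0
  then show ?case using differentiable_imp_continuous_on by auto
qed auto

lemma C_k_on_const: "C_k_on k (\<lambda>x. c) U"
  by (induction k arbitrary: c) auto

lemma C_k_on_bounded_linear:
  assumes "bounded_linear f" "open U"
  shows "C_k_on k f U"
proof (cases k)
  case 0
  then show ?thesis using assms linear_continuous_on by auto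
next
  case (Suc j)
  show ?thesis unfolding Suc
    by (rule C_k_on_SucI[OF \<open>open U\<close>, of f "\<lambda>_. f"])
      (use assms bounded_linear_imp_has_derivative C_k_on_const in auto)
qed

lemma C_k_on_add:
  assumes "C_k_on k f U" "C_k_on k g U" "open U"
  shows "C_k_on k (\<lambda>x. f x + g x) U"
  using assms(1,2)
proof (induction k arbitrary: f g)
  case 0
  then show ?case by (simp add: continuous_on_add)
next
  case (Suc k)
  show ?case
    by (rule C_k_on_SucI[OF \<open>open U\<close>], rule has_derivative_add;
        (rule C_k_on_Suc_derivative[OF _ \<open>open U\<close>]; (rule Suc.prems)?; assumption?)?)
      (use Suc in auto)
qed

lemma C_k_on_bilinear:
  assumes "bounded_bilinear P" "C_k_on k f U" "C_k_on k g U" "open U"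
  shows "C_k_on k (\<lambda>x. P (f x) (g x)) U"
  using assms(2,3)
proof (induction k arbitrary: f g)
  case 0
  then show ?case using bounded_bilinear.continuous_on[OF assms(1)] by simp
next
  case (Suc k)
  have fg: "C_k_on k f U" "C_k_on k g U" using Suc.prems C_k_on_SucD by blast+
  have "((\<lambda>x. P (f x) (g x)) has_derivative
     (\<lambda>v. P (f x) (frechet_derivative g (at x) v) + P (frechet_derivative f (at x) v) (g x))) (at x)"
    if "x \<in> U" for x
    by (intro bounded_bilinear.FDERIV[OF assms(1)] C_k_on_Suc_derivative[OF _ \<open>open U\<close> that])
      (rule Suc.prems)+
  then show ?case
    by (rule C_k_on_SucI[OF \<open>open U\<close>]) (use Suc fg in \<open>auto intro!: C_k_on_add[OF _ _ \<open>open U\<close>]\<close>)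
qed

text \<open>
  Raising to a power \<open>s\<close> has derivative \<open>s y powr (s - 1)\<close>, again a power, so that the induction on
  \<open>k\<close> goes through for all exponents simultaneously.
\<close>

lemma C_k_on_powr:
  fixes f :: "'a::real_normed_vector \<Rightarrow> real"
  assumes "C_k_on k f U" "open U" "\<And>x. x \<in> U \<Longrightarrow> f x > 0"
  shows "C_k_on k (\<lambda>x. f x powr s) U"
  using assms(1)
proof (induction k arbitrary: s)
  case 0
  then show ?case using assms(3) by (force intro!: continuous_intros)
next
  case (Suc k)
  have "((\<lambda>x. f x powr s) has_derivative
      (\<lambda>v. (s * f x powr (s - 1)) * frechet_derivative f (at x) v)) (at x)" if "x \<in> U" for x
  proof -
    have "((\<lambda>y. y powr s) has_derivative (\<lambda>h. (s * f x powr (s - 1)) * h)) (at (f x))"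
      using has_real_derivative_powr[OF assms(3)[OF that], of s]
      by (simp add: has_field_derivative_def)
    then show ?thesis
      using has_derivative_compose[OF C_k_on_Suc_derivative[OF Suc.prems \<open>open U\<close> that]] by blast
  qed
  moreover have "C_k_on k (\<lambda>x. (s * f x powr (s - 1)) * frechet_derivative f (at x) v) U" for v
    using Suc C_k_on_SucD[OF Suc.prems]
    by (intro C_k_on_bilinear[OF bounded_bilinear_mult] C_k_on_const \<open>open U\<close>) auto
  ultimately show ?case by (rule C_k_on_SucI[OF \<open>open U\<close>])
qed

lemma smooth_on_directional: "smooth_on f U \<Longrightarrow> smooth_on (\<lambda>x. frechet_derivative f (at x) v) U"
  unfolding smooth_on_def by (metis C_k_on.simps(2))

lemma smooth_on_pd: "smooth_on f U \<Longrightarrow> smooth_on (pd i f) U"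
  using smooth_on_directional[of f U "axis i 1"] by (simp add: pd_def[abs_def])

lemma smooth_on_has_derivative:
  assumes "smooth_on f U" "open U" "x \<in> U"
  shows "(f has_derivative frechet_derivative f (at x)) (at x)"
  using assms C_k_on_Suc_derivative unfolding smooth_on_def by blast

lemma smooth_on_differentiable: "smooth_on f U \<Longrightarrow> open U \<Longrightarrow> x \<in> U \<Longrightarrow> f differentiable at x"
  using smooth_on_has_derivative unfolding differentiable_def by blast

text \<open>
  The symmetry of real second derivatives, applied to the inner product of \<open>f\<close> with each vector.
\<close>

lemma pd_commute:
  fixes f :: "real^'n \<Rightarrow> 'b::real_inner"
  assumes f: "smooth_on f U" and U: "open U" "x \<in> U"
  shows "pd i (pd j f) x = pd j (pd i f) x"
proof -
  let ?D = "\<lambda>f y. frechet_derivative f (at y)"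
  have "pd i (pd j f) x \<bullet> w = pd j (pd i f) x \<bullet> w" for w
  proof -
    have d: "((\<lambda>y. g y \<bullet> w) has_derivative (\<lambda>v. ?D g y v \<bullet> w)) (at y)"
      if "smooth_on g U" "y \<in> U" for g :: "real^'n \<Rightarrow> 'b" and y
      using smooth_on_has_derivative[OF that(1) U(1) that(2)] by (rule has_derivative_inner_left)
    have c: "continuous_on U (\<lambda>y. ?D (\<lambda>y. ?D f y u) y v \<bullet> w)" for u v
      using smooth_on_directional[OF smooth_on_directional[OF f]] unfolding smooth_on_def
      by (intro continuous_intros) (metis C_k_on.simps(1))
    show ?thesis
      unfolding pd_def
      by (rule second_derivative_symmetric_real[OF U d[OF f] d[OF smooth_on_directional[OF f]]
            d[OF smooth_on_directional[OF f]] c c])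
  qed
  then show ?thesis by (metis vector_eq_rdot)
qed

section \<open>Polarised cubic forms and the Aronhold invariant\<close>

lemma polar3_commute:
  shows "polar3 f u v w = polar3 f v u w" "polar3 f u v w = polar3 f u w v"
  by (simp_all add: polar3_def add_ac)

text \<open>
  Expanding the polarisation of a general cubic form at one stroke produces a very large
  polynomial. Monomials are small, and polarisation is additive in the form.
\<close>

lemma polar3_monomial:
  fixes c :: real
  shows "polar3 (\<lambda>v. c * (v$i * v$j * v$k)) u v w =
    c * (u$i * v$j * w$k + u$i * v$k * w$j + u$j * v$i * w$k
       + u$j * v$k * w$i + u$k * v$i * w$j + u$k * v$j * w$i) / 6"
  by (simp add: polar3_def algebra_simps)

lemma polar3_add: "polar3 (\<lambda>v. f v + g v) u v w = polar3 f u v w + polar3 g u v w"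
  by (simp add: polar3_def add_divide_distrib diff_divide_distrib)

lemma polar3_cubic_form:
  "polar3 (cubic_form (Cubic a b c a2 a3 b1 b3 c1 c2 m)) u v w =
     a * (u$1 * v$1 * w$1) + b * (u$2 * v$2 * w$2) + c * (u$3 * v$3 * w$3)
   + a2 * (u$2 * v$1 * w$1 + u$1 * v$2 * w$1 + u$1 * v$1 * w$2)
   + a3 * (u$3 * v$1 * w$1 + u$1 * v$3 * w$1 + u$1 * v$1 * w$3)
   + b1 * (u$1 * v$2 * w$2 + u$2 * v$1 * w$2 + u$2 * v$2 * w$1)
   + b3 * (u$3 * v$2 * w$2 + u$2 * v$3 * w$2 + u$2 * v$2 * w$3)
   + c1 * (u$1 * v$3 * w$3 + u$3 * v$1 * w$3 + u$3 * v$3 * w$1)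
   + c2 * (u$2 * v$3 * w$3 + u$3 * v$2 * w$3 + u$3 * v$3 * w$2)
   + m * (u$1 * v$2 * w$3 + u$1 * v$3 * w$2 + u$2 * v$1 * w$3
        + u$2 * v$3 * w$1 + u$3 * v$1 * w$2 + u$3 * v$2 * w$1)"
proof -
  have "cubic_form (Cubic a b c a2 a3 b1 b3 c1 c2 m) =
    (\<lambda>v. a * (v$1 * v$1 * v$1) + b * (v$2 * v$2 * v$2) + c * (v$3 * v$3 * v$3)
       + (3 * a2) * (v$1 * v$1 * v$2) + (3 * a3) * (v$1 * v$1 * v$3)
       + (3 * b1) * (v$1 * v$2 * v$2) + (3 * b3) * (v$2 * v$2 * v$3)
       + (3 * c1) * (v$1 * v$3 * v$3) + (3 * c2) * (v$2 * v$3 * v$3)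
       + (6 * m) * (v$1 * v$2 * v$3))"
    by (simp add: fun_eq_iff Let_def power2_eq_square power3_eq_cube)
  then show ?thesis
    by (simp only: polar3_add polar3_monomial) (simp add: field_simps)
qed

lemma polar3_cubic_form_linear:
  shows "linear (\<lambda>u. polar3 (cubic_form F) u v w)"
    and "linear (\<lambda>v. polar3 (cubic_form F) u v w)"
    and "linear (\<lambda>w. polar3 (cubic_form F) u v w)"
proof -
  obtain a b c a2 a3 b1 b3 c1 c2 m where F: "F = Cubic a b c a2 a3 b1 b3 c1 c2 m"
    by (cases F)
  show *: "linear (\<lambda>u. polar3 (cubic_form F) u v w)" for v w
    unfolding F polar3_cubic_form by (rule linearI) (simp_all add: algebra_simps)
  show "linear (\<lambda>v. polar3 (cubic_form F) u v w)"
    using *[of u w] by (simp add: polar3_commute(1)[of _ u])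
  show "linear (\<lambda>w. polar3 (cubic_form F) u v w)"
    using *[of u v] by (simp add: polar3_commute(1)[of _ _ u] polar3_commute(2)[of _ u v])
qed

lemmas polar3_simps =
  linear_add[OF polar3_cubic_form_linear(1)] linear_add[OF polar3_cubic_form_linear(2)]
  linear_add[OF polar3_cubic_form_linear(3)]
  linear_scale[OF polar3_cubic_form_linear(1)] linear_scale[OF polar3_cubic_form_linear(2)]
  linear_scale[OF polar3_cubic_form_linear(3)]

lemma polar3_diagonal: "polar3 (cubic_form F) u u u = cubic_form F u"
proof (cases F)
  case (Cubic a b c a2 a3 b1 b3 c1 c2 m)
  show ?thesis unfolding Cubic polar3_cubic_form
    by (simp add: Let_def power2_eq_square power3_eq_cube algebra_simps)
qed

lemma cubic_form_scaleR: "cubic_form F (c *\<^sub>R u) = c ^ 3 * cubic_form F u"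
  by (simp add: polar3_simps power3_eq_cube flip: polar3_diagonal)

text \<open>
  The cubic form \<open>F\<close> composed with the linear map \<open>A\<close>. Its coefficients are the values of the polarised
  form on the columns of \<open>A\<close>.
\<close>

definition cubic_subst :: "ternary_cubic \<Rightarrow> real^3^3 \<Rightarrow> ternary_cubic" where
  "cubic_subst F A =
     (let T = polar3 (cubic_form F); p = column 1 A; q = column 2 A; r = column 3 A in
      Cubic (T p p p) (T q q q) (T r r r) (T p p q) (T p p r) (T p q q) (T q q r)
        (T p r r) (T q r r) (T p q r))"

lemma matrix_vector_mult_columns_3:
  "A *v x = x$1 *\<^sub>R column 1 A + x$2 *\<^sub>R column 2 A + x$3 *\<^sub>R column 3 A"
  for A :: "real^3^'n"
  by (simp add: vec_eq_iff matrix_vector_mult_def column_def sum_3 mult.commute)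

lemma cubic_form_subst: "cubic_form (cubic_subst F A) x = cubic_form F (A *v x)"
proof -
  define p q r where "p = column 1 A" and "q = column 2 A" and "r = column 3 A"
  let ?T = "polar3 (cubic_form F)"
  have sym: "?T p q p = ?T p p q" "?T q p p = ?T p p q" "?T p r p = ?T p p r" "?T r p p = ?T p p r"
    "?T q p q = ?T p q q" "?T q q p = ?T p q q" "?T q r q = ?T q q r" "?T r q q = ?T q q r"
    "?T r p r = ?T p r r" "?T r r p = ?T p r r" "?T r q r = ?T q r r" "?T r r q = ?T q r r"
    "?T p r q = ?T p q r" "?T q p r = ?T p q r" "?T q r p = ?T p q r" "?T r p q = ?T p q r"
    "?T r q p = ?T p q r"
    by (metis polar3_commute)+
  have "cubic_form F (A *v x) =
     ?T (x$1 *\<^sub>R p + x$2 *\<^sub>R q + x$3 *\<^sub>R r) (x$1 *\<^sub>R p + x$2 *\<^sub>R q + x$3 *\<^sub>R r)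
        (x$1 *\<^sub>R p + x$2 *\<^sub>R q + x$3 *\<^sub>R r)"
    by (simp only: polar3_diagonal matrix_vector_mult_columns_3 p_def q_def r_def)
  also have "\<dots> = cubic_form (cubic_subst F A) x"
    by (simp add: polar3_simps cubic_subst_def Let_def sym flip: p_def q_def r_def)
      (simp add: algebra_simps power2_eq_square power3_eq_cube)
  finally show ?thesis by simp
qed

lemma polar3_subst:
  "polar3 (cubic_form (cubic_subst F A)) u v w = polar3 (cubic_form F) (A *v u) (A *v v) (A *v w)"
  by (simp add: polar3_def cubic_form_subst matrix_vector_right_distrib)

lemma cubic_subst_mult: "cubic_subst F (A ** B) = cubic_subst (cubic_subst F A) B"
proof -
  have "column j (A ** B) = A *v column j B" for j
    by (simp add: vec_eq_iff column_def matrix_matrix_mult_def matrix_vector_mult_def)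
  then show ?thesis
    by (simp add: cubic_subst_def[of _ "A ** B"] cubic_subst_def[of _ B] polar3_subst Let_def)
qed

lemma aronhold_S_diagonal:
  assumes "\<And>i j. i \<noteq> j \<Longrightarrow> A$i$j = 0"
  shows "aronhold_S (cubic_subst F A) = det A ^ 4 * aronhold_S F"
proof (cases F)
  case (Cubic a b c a2 a3 b1 b3 c1 c2 m)
  have "A$1$2 = 0" "A$1$3 = 0" "A$2$1 = 0" "A$2$3 = 0" "A$3$1 = 0" "A$3$2 = 0"
    using assms by auto
  then show ?thesis
    by (simp add: Cubic cubic_subst_def Let_def polar3_cubic_form column_def det_3)
      (simp add: algebra_simps power2_eq_square power4_eq_xxxx)
qed

lemma aronhold_S_swap:
  fixes i j :: 3
  assumes "i \<noteq> j"
  shows "aronhold_S (cubic_subst F (\<chi> k l. mat 1 $ k $ Transposition.transpose i j l))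
    = det (\<chi> k l. mat 1 $ k $ Transposition.transpose i j l :: real^3^3) ^ 4 * aronhold_S F"
proof (cases F)
  case (Cubic a b c a2 a3 b1 b3 c1 c2 m)
  show ?thesis
    using assms exhaust_3[of i] exhaust_3[of j]
    apply (elim disjE; hypsubst?; (simp; fail)?)
    apply (simp_all add: Cubic cubic_subst_def Let_def polar3_cubic_form column_def det_3
        mat_def Transposition.transpose_def)
    apply (simp_all add: algebra_simps)
    done
qed

lemma aronhold_S_shear:
  fixes i j :: 3
  assumes "i \<noteq> j"
  shows "aronhold_S (cubic_subst F (\<chi> k l. if k = i \<and> l = j then t else of_bool (k = l)))
    = det (\<chi> k l. if k = i \<and> l = j then t else of_bool (k = l) :: real^3^3) ^ 4 * aronhold_S F"
proof (cases F)
  case (Cubic a b c a2 a3 b1 b3 c1 c2 m)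
  show ?thesis
    using assms exhaust_3[of i] exhaust_3[of j]
    apply (elim disjE; hypsubst?; (simp; fail)?)
    apply (simp_all add: Cubic cubic_subst_def Let_def polar3_cubic_form column_def det_3)
    apply (simp_all add: algebra_simps power2_eq_square power4_eq_xxxx)
    done
qed

text \<open>
  The matrices with this property, for all \<open>F\<close>, are closed under products, and every invertible matrix is a
  product of diagonal matrices, transpositions and shears. For each of these factors the property is
  a polynomial identity in the coefficients of \<open>F\<close>. The hypothesis on the determinant disposes of the
  matrices with a zero row, which also occur among the generators of the induction rule.
\<close>

lemma aronhold_S_subst:
  assumes "det A \<noteq> 0"
  shows "aronhold_S (cubic_subst F A) = det A ^ 4 * aronhold_S F"
proof -
  have "det A \<noteq> 0 \<longrightarrow> (\<forall>F. aronhold_S (cubic_subst F A) = det A ^ 4 * aronhold_S F)"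
  proof (rule induct_matrix_elementary[of _ A])
    fix A :: "real^3^3" and i
    assume "row i A = 0"
    then show "det A \<noteq> 0 \<longrightarrow> (\<forall>F. aronhold_S (cubic_subst F A) = det A ^ 4 * aronhold_S F)"
      using det_zero_row by blast
  qed (auto simp: cubic_subst_mult det_mul power_mult_distrib
      aronhold_S_diagonal aronhold_S_swap aronhold_S_shear)
  then show ?thesis using assms by blast
qed

text \<open>
  The shape of a cubic form in a basis whose first vector is orthogonal to the other two with
  respect to the quadratic form that it defines.
\<close>

lemma aronhold_S_adapted:
  "aronhold_S (Cubic A a30 a03 0 0 (-p) a21 (-r) a12 (-q)) =
    (p * r - q\<^sup>2)\<^sup>2 + A * (p * (a12\<^sup>2 - a21 * a03) + q * (a30 * a03 - a21 * a12) + r * (a21\<^sup>2 - a30 * a12))"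
  by (simp add: algebra_simps power2_eq_square power4_eq_xxxx)

lemma polar3_cubic_form_expand:
  "polar3 (cubic_form F) u v w = (\<Sum>i\<in>UNIV. u$i * polar3 (cubic_form F) (axis i 1) v w)"
proof -
  have "polar3 (cubic_form F) u v w = polar3 (cubic_form F) (\<Sum>i\<in>UNIV. u$i *\<^sub>R axis i 1) v w"
    by (simp add: basis_expansion flip: scalar_mult_eq_scaleR)
  also have "\<dots> = (\<Sum>i\<in>UNIV. u$i * polar3 (cubic_form F) (axis i 1) v w)"
    by (simp add: linear_sum[OF polar3_cubic_form_linear(1)] polar3_simps)
  finally show ?thesis .
qed

text \<open>
  Writing the trilinear form as an inner product with a bounded bilinear map reduces its
  differentiability and smoothness to those of bilinear maps.
\<close>

lemma polar3_cubic_form_eq_inner: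
  obtains Q :: "real^3 \<Rightarrow> real^3 \<Rightarrow> real^3" where "bounded_bilinear Q"
    "\<And>u v w. polar3 (cubic_form F) u v w = u \<bullet> Q v w"
proof -
  let ?T = "polar3 (cubic_form F)"
  define Q where "Q v w = (\<chi> i. ?T (axis i 1) v w)" for v w
  have T: "?T u v w = u \<bullet> Q v w" for u v w
    by (subst polar3_cubic_form_expand) (simp add: inner_vec_def Q_def)
  have "bilinear Q"
    by (auto simp: bilinear_def Q_def vec_eq_iff polar3_simps intro!: linearI)
  then show thesis using that T by (simp add: bilinear_conv_bounded_bilinear)
qed

lemma has_derivative_polar3:
  assumes "(f has_derivative f') (at x within S)" "(g has_derivative g') (at x within S)"
    "(h has_derivative h') (at x within S)"
  shows "((\<lambda>x. polar3 (cubic_form F) (f x) (g x) (h x)) has_derivative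
    (\<lambda>v. polar3 (cubic_form F) (f' v) (g x) (h x) + polar3 (cubic_form F) (f x) (g' v) (h x)
       + polar3 (cubic_form F) (f x) (g x) (h' v))) (at x within S)"
proof -
  obtain Q where Q: "bounded_bilinear Q" and T: "\<And>u v w. polar3 (cubic_form F) u v w = u \<bullet> Q v w"
    using polar3_cubic_form_eq_inner by blast
  show ?thesis
    unfolding T
    by (rule has_derivative_eq_rhs,
        rule has_derivative_inner[OF assms(1) bounded_bilinear.FDERIV[OF Q assms(2,3)]])
      (simp add: inner_add_right add_ac)
qed

lemma C_k_on_cubic_form:
  assumes "C_k_on k f U" "open U"
  shows "C_k_on k (\<lambda>x. cubic_form F (f x)) U"
proof -
  obtain Q where Q: "bounded_bilinear Q" "\<And>u v w. polar3 (cubic_form F) u v w = u \<bullet> Q v w"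
    using polar3_cubic_form_eq_inner by blast
  have "C_k_on k (\<lambda>x. f x \<bullet> Q (f x) (f x)) U"
    by (intro C_k_on_bilinear[OF bounded_bilinear_inner] C_k_on_bilinear[OF Q(1)] assms)
  then show ?thesis by (simp add: polar3_diagonal flip: Q(2))
qed

lemma cubic_form_has_derivative:
  "(cubic_form F has_derivative (\<lambda>v. 3 * polar3 (cubic_form F) y v y)) (at y within S)"
  using has_derivative_polar3[OF has_derivative_ident has_derivative_ident has_derivative_ident,
      of F y S] polar3_commute[of "cubic_form F"]
  by (simp add: polar3_diagonal)

lemma pd_polar3:
  assumes "f differentiable at x" "g differentiable at x" "h differentiable at x"
  shows "pd i (\<lambda>y. polar3 (cubic_form F) (f y) (g y) (h y)) x =
    polar3 (cubic_form F) (pd i f x) (g x) (h x) + polar3 (cubic_form F) (f x) (pd i g x) (h x)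
    + polar3 (cubic_form F) (f x) (g x) (pd i h x)"
  using pd_eqI[OF has_derivative_polar3[OF assms[unfolded frechet_derivative_works]]]
  by (simp add: pd_def)

lemma differentiable_polar3:
  assumes "f differentiable at x" "g differentiable at x" "h differentiable at x"
  shows "(\<lambda>y. polar3 (cubic_form F) (f y) (g y) (h y)) differentiable at x"
  using has_derivative_polar3[OF assms[unfolded frechet_derivative_works]] differentiable_def by blast

lemma hessian_det_cubic_form:
  "hessian_det (cubic_form F) x
    = 216 * det (\<chi> i j. polar3 (cubic_form F) x (axis i 1) (axis j 1))"
proof -
  let ?T = "polar3 (cubic_form F)"
  have id: "((\<lambda>y. y) has_derivative (\<lambda>v. v)) (at y)" for y :: "real^3"
    by (rule has_derivative_ident)
  have "(cubic_form F has_derivative (\<lambda>v. 3 * ?T y v y)) (at y)" for y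
    by (rule cubic_form_has_derivative)
  then have "pd j (cubic_form F) = (\<lambda>y. 3 * ?T y (axis j 1) y)" for j
    using pd_eqI by blast
  moreover have "((\<lambda>y. 3 * ?T y (axis j 1) y) has_derivative (\<lambda>v. 6 * ?T x v (axis j 1))) (at x)" for j
    using has_derivative_mult_right[OF has_derivative_polar3[OF id has_derivative_const id, of F "axis j 1" x], of 3]
      polar3_commute[of "cubic_form F"] by (simp add: linear_0[OF polar3_cubic_form_linear(2)])
  ultimately have "pd i (pd j (cubic_form F)) x = 6 * ?T x (axis i 1) (axis j 1)" for i j
    using pd_eqI by fastforce
  then have "hessian_det (cubic_form F) x = det (\<chi> i j. 6 * ?T x (axis i 1) (axis j 1))"
    by (simp add: hessian_det_def)
  then show ?thesis
    by (simp add: det_3)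
qed

lemma det_gram_polar3:
  "det (\<chi> i j. polar3 (cubic_form F) u (column i A) (column j A))
    = (det A)\<^sup>2 * det (\<chi> i j. polar3 (cubic_form F) u (axis i 1) (axis j 1))"
    (is "det ?N = _ * det ?M")
proof -
  let ?T = "polar3 (cubic_form F)"
  have col: "column j A = (\<Sum>k\<in>UNIV. A$k$j *\<^sub>R axis k 1)" for j
    using basis_expansion[of "column j A"] by (simp add: column_def scalar_mult_eq_scaleR)
  have "?T u (column i A) (column j A) = (\<Sum>k\<in>UNIV. \<Sum>l\<in>UNIV. A$k$i * A$l$j * ?T u (axis k 1) (axis l 1))" for i j
    unfolding col
    by (subst sum.swap)
      (simp add: linear_sum[OF polar3_cubic_form_linear(2)] linear_sum[OF polar3_cubic_form_linear(3)]
        polar3_simps sum_distrib_left mult_ac)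
  then have "?N = transpose A ** ?M ** A"
    by (simp add: vec_eq_iff matrix_matrix_mult_def transpose_def sum_3 algebra_simps)
  then show ?thesis by (simp add: det_mul power2_eq_square)
qed

section \<open>Gaussian curvature from Christoffel symbols of the first kind\<close>

text \<open>
  The Christoffel symbol of the first kind \<open>\<Gamma>\<^sub>i\<^sub>j\<^sub>,\<^sub>l\<close>. It involves no inverse of the metric, hence is
  much easier to differentiate than \<open>\<Gamma>\<^sup>l\<^sub>i\<^sub>j\<close>.
\<close>

definition christoffel_lower ::
  "(real^'n \<Rightarrow> real^'n^'n) \<Rightarrow> 'n \<Rightarrow> 'n \<Rightarrow> 'n \<Rightarrow> real^'n \<Rightarrow> real" where
  "christoffel_lower g i j l x =
     (pd i (\<lambda>y. g y $ j $ l) x + pd j (\<lambda>y. g y $ i $ l) x - pd l (\<lambda>y. g y $ i $ j) x) / 2"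

lemma matrix_inv_right_mult:
  fixes A :: "real^'n^'n"
  assumes "det A \<noteq> 0"
  shows "A ** matrix_inv A = mat 1"
proof -
  have "\<exists>B. A ** B = mat 1 \<and> B ** A = mat 1"
    using assms by (simp add: invertible_det_nz[symmetric] invertible_def)
  then show ?thesis unfolding matrix_inv_def by (rule someI2_ex) simp
qed

lemma matrix_inv_2:
  fixes A :: "real^2^2"
  assumes "det A \<noteq> 0"
  shows "matrix_inv A $ 1 $ 1 = A $ 2 $ 2 / det A" "matrix_inv A $ 2 $ 2 = A $ 1 $ 1 / det A"
    "matrix_inv A $ 1 $ 2 = - A $ 1 $ 2 / det A" "matrix_inv A $ 2 $ 1 = - A $ 2 $ 1 / det A"
proof -
  define B :: "real^2^2"
    where "B = vector [vector [A$2$2 / det A, - A$1$2 / det A], vector [- A$2$1 / det A, A$1$1 / det A]]"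
  have "A ** B = mat 1"
    using assms
    by (simp add: vec_eq_iff forall_2 matrix_matrix_mult_def sum_2 mat_def B_def divide_simps)
      (simp add: det_2 algebra_simps)
  then have "matrix_inv A = B"
    using matrix_inv_right_mult[OF assms] assms
    by (metis matrix_left_right_inverse matrix_mul_assoc matrix_mul_lid matrix_mul_rid)
  then show "matrix_inv A $ 1 $ 1 = A $ 2 $ 2 / det A" "matrix_inv A $ 2 $ 2 = A $ 1 $ 1 / det A"
    "matrix_inv A $ 1 $ 2 = - A $ 1 $ 2 / det A" "matrix_inv A $ 2 $ 1 = - A $ 2 $ 1 / det A"
    by (simp_all add: B_def)
qed

lemma christoffel_eq_raised:
  "christoffel g k i j x = (\<Sum>l\<in>UNIV. matrix_inv (g x) $ k $ l * christoffel_lower g i j l x)"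
  by (simp add: christoffel_def christoffel_lower_def sum_divide_distrib)

lemma christoffel_lower_eq:
  assumes "det (g x) \<noteq> 0"
  shows "(\<Sum>k\<in>UNIV. g x $ m $ k * christoffel g k i j x) = christoffel_lower g i j m x"
proof -
  have "(\<Sum>k\<in>UNIV. g x $ m $ k * christoffel g k i j x) =
      (g x *v (matrix_inv (g x) *v (\<chi> l. christoffel_lower g i j l x))) $ m"
    by (simp add: christoffel_eq_raised matrix_vector_mult_def)
  also have "\<dots> = christoffel_lower g i j m x"
    using matrix_inv_right_mult[OF assms] by (simp add: matrix_vector_mul_assoc)
  finally show ?thesis .
qed

text \<open>
  This is the classical formula
  \<open>R\<^sub>1\<^sub>2\<^sub>1\<^sub>2 = \<partial>\<^sub>1 \<Gamma>\<^sub>2\<^sub>2\<^sub>,\<^sub>1 - \<partial>\<^sub>2 \<Gamma>\<^sub>1\<^sub>2\<^sub>,\<^sub>1 - (\<Gamma>\<^sub>1\<^sub>1\<^sub>,\<^sub>l \<Gamma>\<^sup>l\<^sub>2\<^sub>2 - \<Gamma>\<^sub>1\<^sub>2\<^sub>,\<^sub>l \<Gamma>\<^sup>l\<^sub>1\<^sub>2)\<close>. Lowering the index under the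
  derivative costs a term \<open>(\<partial>\<^sub>i g\<^sub>1\<^sub>l) \<Gamma>\<^sup>l\<close>, and \<open>\<partial>\<^sub>i g\<^sub>1\<^sub>l = \<Gamma>\<^sub>i\<^sub>1\<^sub>,\<^sub>l + \<Gamma>\<^sub>i\<^sub>l\<^sub>,\<^sub>1\<close>; the second half of it cancels the
  quadratic terms in the definition of the curvature tensor.
\<close>

lemma gauss_curvature_lower:
  fixes g :: "real^2 \<Rightarrow> real^2^2"
  assumes U: "open U" "x \<in> U"
    and sym: "\<And>y i j. y \<in> U \<Longrightarrow> g y $ i $ j = g y $ j $ i"
    and det: "\<And>y. y \<in> U \<Longrightarrow> det (g y) \<noteq> 0"
    and dg: "\<And>i j. (\<lambda>y. g y $ i $ j) differentiable at x"
    and dL: "\<And>i j l. christoffel_lower g i j l differentiable at x"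
  shows "gauss_curvature g x * det (g x) =
    pd 1 (christoffel_lower g 2 2 1) x - pd 2 (christoffel_lower g 1 2 1) x
    - (\<Sum>l\<in>UNIV. christoffel_lower g 1 1 l x * christoffel g l 2 2 x
               - christoffel_lower g 1 2 l x * christoffel g l 1 2 x)"
proof -
  define L where "L i j l = christoffel_lower g i j l x" for i j l
  define G where "G l i j = christoffel g l i j x" for i j l
  have LG: "g x $ m $ 1 * G 1 i j + g x $ m $ 2 * G 2 i j = L i j m" for i j m
    using christoffel_lower_eq[of g x m i j, OF det[OF U(2)]] by (simp add: L_def G_def sum_2)
  have Lsym: "L i j l = L j i l" for i j l
    using pd_cong_open[OF U, of "\<lambda>y. g y $ i $ j" "\<lambda>y. g y $ j $ i"] sym dg
    by (simp add: L_def christoffel_lower_def)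
  have pdg: "pd i (\<lambda>y. g y $ j $ l) x = L i j l + L i l j" for i j l
    using pd_cong_open[OF U, of "\<lambda>y. g y $ j $ l" "\<lambda>y. g y $ l $ j"]
      pd_cong_open[OF U, of "\<lambda>y. g y $ i $ j" "\<lambda>y. g y $ j $ i"]
      pd_cong_open[OF U, of "\<lambda>y. g y $ i $ l" "\<lambda>y. g y $ l $ i"] sym dg
    by (simp add: L_def christoffel_lower_def field_simps)
  \<comment> \<open>Cramer's rule exhibits \<open>\<Gamma>\<^sup>l\<^sub>i\<^sub>j\<close> as a quotient of differentiable functions\<close>
  have dG: "christoffel g l i j differentiable at x" for l i j
  proof -
    let ?d = "\<lambda>y. g y $ 1 $ 1 * g y $ 2 $ 2 - g y $ 1 $ 2 * g y $ 2 $ 1"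
    let ?L = "christoffel_lower g i j"
    have d: "?d x \<noteq> 0" using det[OF U(2)] by (simp add: det_2)
    have "(\<lambda>y. (g y $ 2 $ 2 * ?L 1 y - g y $ 1 $ 2 * ?L 2 y) / ?d y) differentiable at x"
      "(\<lambda>y. (g y $ 1 $ 1 * ?L 2 y - g y $ 2 $ 1 * ?L 1 y) / ?d y) differentiable at x"
      using d by (intro differentiable_divide differentiable_diff differentiable_mult dg dL; simp)+
    moreover have "(g y $ 2 $ 2 * ?L 1 y - g y $ 1 $ 2 * ?L 2 y) / ?d y = christoffel g 1 i j y"
      "(g y $ 1 $ 1 * ?L 2 y - g y $ 2 $ 1 * ?L 1 y) / ?d y = christoffel g 2 i j y" if "y \<in> U" for y
      using matrix_inv_2[OF det[OF that]]
      by (simp_all add: christoffel_eq_raised det_2 sum_2 diff_divide_distrib)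
    ultimately have "christoffel g 1 i j differentiable at x" "christoffel g 2 i j differentiable at x"
      using differentiable_transform_open[OF U] by (metis (lifting))+
    then show ?thesis using exhaust_2[of l] by auto
  qed
  \<comment> \<open>the product rule for \<open>g\<^sub>m\<^sub>l \<Gamma>\<^sup>l\<^sub>j\<^sub>k = \<Gamma>\<^sub>j\<^sub>k\<^sub>,\<^sub>m\<close>\<close>
  have pdL: "g x $ m $ 1 * pd i (christoffel g 1 j k) x + g x $ m $ 2 * pd i (christoffel g 2 j k) x
      = pd i (christoffel_lower g j k m) x
        - (L i m 1 + L i 1 m) * G 1 j k - (L i m 2 + L i 2 m) * G 2 j k" for i j k m
  proof -
    have "pd i (christoffel_lower g j k m) x =
        pd i (\<lambda>y. g y $ m $ 1 * christoffel g 1 j k y + g y $ m $ 2 * christoffel g 2 j k y) x"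
      using christoffel_lower_eq[of g _ m j k] det
      by (intro pd_cong_open[OF U _ dL]) (simp add: sum_2)
    also have "\<dots> = (L i m 1 + L i 1 m) * G 1 j k + g x $ m $ 1 * pd i (christoffel g 1 j k) x
        + ((L i m 2 + L i 2 m) * G 2 j k + g x $ m $ 2 * pd i (christoffel g 2 j k) x)"
      by (simp add: pd_add pd_mult dg dG pdg G_def differentiable_mult)
    finally show ?thesis by simp
  qed
  have "gauss_curvature g x * det (g x) =
     (g x $ 1 $ 1 * pd 1 (christoffel g 1 2 2) x + g x $ 1 $ 2 * pd 1 (christoffel g 2 2 2) x)
   - (g x $ 1 $ 1 * pd 2 (christoffel g 1 1 2) x + g x $ 1 $ 2 * pd 2 (christoffel g 2 1 2) x)
   + (g x $ 1 $ 1 * G 1 1 1 + g x $ 1 $ 2 * G 2 1 1) * G 1 2 2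
   + (g x $ 1 $ 1 * G 1 1 2 + g x $ 1 $ 2 * G 2 1 2) * G 2 2 2
   - (g x $ 1 $ 1 * G 1 2 1 + g x $ 1 $ 2 * G 2 2 1) * G 1 1 2
   - (g x $ 1 $ 1 * G 1 2 2 + g x $ 1 $ 2 * G 2 2 2) * G 2 1 2"
    using det[OF U(2)]
    by (simp add: gauss_curvature_def riemann_def sum_2 flip: G_def) (simp add: algebra_simps)
  also have "\<dots> = pd 1 (christoffel_lower g 2 2 1) x - pd 2 (christoffel_lower g 1 2 1) x
    - (\<Sum>l\<in>UNIV. L 1 1 l * G l 2 2 - L 1 2 l * G l 1 2)"
    unfolding LG pdL by (simp add: sum_2 Lsym[of 2 1]) (simp add: algebra_simps)
  finally show ?thesis by (simp add: L_def G_def)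
qed

section \<open>The index cone\<close>

lemma isCont_polar3:
  assumes "isCont f x" "isCont g x" "isCont h x"
  shows "isCont (\<lambda>x. polar3 (cubic_form F) (f x) (g x) (h x)) x"
proof -
  have F: "isCont (cubic_form F) y" for y
    using cubic_form_has_derivative has_derivative_continuous by blast
  show ?thesis
    unfolding polar3_def by (intro continuous_intros isCont_o2[OF _ F] assms) simp
qed

lemma has_signature_scale:
  assumes "c > 0" "\<And>u v. B' u v = c * B u v" "has_signature B p q"
  shows "has_signature B' p q"
  using assms unfolding has_signature_def
  by (simp add: zero_less_mult_iff mult_less_0_iff)

lemma index_cone_scaleR:
  assumes "D \<in> index_cone (cubic_form F)" "c > 0"
  shows "c *\<^sub>R D \<in> index_cone (cubic_form F)"
  using assms has_signature_scale[of c "polar3 (cubic_form F) (c *\<^sub>R D)" "polar3 (cubic_form F) D" 1 2]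
  by (simp add: index_cone_def cubic_form_scaleR polar3_simps)

text \<open>
  In dimension three the one positive and the two negative vectors already make up the whole
  orthogonal basis.
\<close>

lemma has_signature_1_2E:
  fixes B :: "real^3 \<Rightarrow> real^3 \<Rightarrow> real"
  assumes "has_signature B 1 2"
  obtains u v w where "span {u, v, w} = UNIV"
    "pairwise (\<lambda>x y. B x y = 0) {u, v, w}" "u \<noteq> v" "u \<noteq> w" "v \<noteq> w"
    "B u u > 0" "B v v < 0" "B w w < 0"
proof -
  obtain E where E: "independent E" "span E = UNIV" "pairwise (\<lambda>u v. B u v = 0) E"
    and c: "card {e \<in> E. B e e > 0} = 1" "card {e \<in> E. B e e < 0} = 2"
    using assms unfolding has_signature_def by blast
  obtain u where u: "{e \<in> E. B e e > 0} = {u}" using c(1) card_1_singletonE by blast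
  obtain v w where vw: "{e \<in> E. B e e < 0} = {v, w}" "v \<noteq> w" using c(2) unfolding card_2_iff by blast
  have signs: "B u u > 0" "B v v < 0" "B w w < 0" using u vw by blast+
  then have ne: "u \<noteq> v" "u \<noteq> w" by auto
  have "card E = dim (span E)" using E(1) by (metis dim_span_eq_card_independent)
  then have cE: "card E = 3" unfolding E(2) by simp
  have sub: "{u, v, w} \<subseteq> E" using u vw by blast
  have "{u, v, w} = E"
    by (rule card_subset_eq[OF _ sub]) (use cE ne vw(2) in \<open>simp_all add: card_ge_0_finite\<close>)
  then show thesis using that[of u v w] E signs ne vw(2) by blast
qed

lemma orthogonal_nonisotropic_independent:
  fixes B :: "'a::real_vector \<Rightarrow> 'a \<Rightarrow> real"
  assumes "finite E" "\<And>y. linear (\<lambda>x. B x y)" "pairwise (\<lambda>x y. B x y = 0) E"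
    "\<And>e. e \<in> E \<Longrightarrow> B e e \<noteq> 0"
  shows "independent E"
proof -
  have "a e = 0" if "(\<Sum>x\<in>E. a x *\<^sub>R x) = 0" "e \<in> E" for a e
  proof -
    have "0 = B (\<Sum>x\<in>E. a x *\<^sub>R x) e" using that(1) linear_0[OF assms(2)] by simp
    also have "\<dots> = (\<Sum>x\<in>E. a x * B x e)"
      by (simp add: linear_sum[OF assms(2)] linear_scale[OF assms(2)])
    also have "\<dots> = (\<Sum>x\<in>E. if x = e then a e * B e e else 0)"
      using assms(3) that(2) by (intro sum.cong) (auto simp: pairwise_def)
    also have "\<dots> = a e * B e e" using assms(1) that(2) by simp
    finally show ?thesis using assms(4)[OF that(2)] by simp
  qed
  then show ?thesis using dependent_finite[OF assms(1)] by blast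
qed

lemma has_signature_1_2I:
  fixes B :: "real^3 \<Rightarrow> real^3 \<Rightarrow> real"
  assumes lin: "\<And>y. linear (\<lambda>x. B x y)" and sym: "\<And>x y. B x y = B y x"
    and orth: "B u v = 0" "B u w = 0" "B v w = 0"
    and signs: "B u u > 0" "B v v < 0" "B w w < 0"
  shows "has_signature B 1 2"
proof -
  let ?E = "{u, v, w}"
  have ne: "u \<noteq> v" "u \<noteq> w" "v \<noteq> w" using orth signs by auto
  have pw: "pairwise (\<lambda>x y. B x y = 0) ?E"
    using orth sym by (auto simp: pairwise_insert)
  have ind: "independent ?E"
    by (rule orthogonal_nonisotropic_independent[OF _ lin pw]) (use signs in auto)
  have "span ?E = UNIV"
    using card_ge_dim_independent[of ?E UNIV, OF _ ind] ne by auto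
  moreover have "{e \<in> ?E. B e e > 0} = {u}" "{e \<in> ?E. B e e < 0} = {v, w}"
    using signs by auto
  ultimately show ?thesis
    unfolding has_signature_def using ind pw ne by (intro exI[of _ ?E]) simp
qed

lemma index_cone_nondegenerate:
  assumes D: "D \<in> index_cone (cubic_form F)" and z: "\<And>w. polar3 (cubic_form F) D z w = 0"
  shows "z = 0"
proof -
  let ?B = "polar3 (cubic_form F) D"
  obtain u v w where E: "span {u, v, w} = UNIV" "pairwise (\<lambda>x y. ?B x y = 0) {u, v, w}"
    and ne: "u \<noteq> v" "u \<noteq> w" "v \<noteq> w" and signs: "?B u u > 0" "?B v v < 0" "?B w w < 0"
  proof -
    have "has_signature ?B 1 2" using D by (simp add: index_cone_def)
    then show thesis using that by (rule has_signature_1_2E)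
  qed
  have "z \<in> span {u, v, w}" using E(1) by simp
  then obtain a b c where zc: "z = a *\<^sub>R u + b *\<^sub>R v + c *\<^sub>R w"
    unfolding span_breakdown_eq span_empty by (auto simp: diff_eq_eq add_ac)
  have o: "?B u v = 0" "?B v u = 0" "?B u w = 0" "?B w u = 0" "?B v w = 0" "?B w v = 0"
    using E(2) ne by (auto simp: pairwise_insert)
  have "a * ?B u u = 0" "b * ?B v v = 0" "c * ?B w w = 0"
    using z[of u] z[of v] z[of w] o by (simp_all add: zc polar3_simps)
  then show ?thesis using signs zc by simp
qed

lemma det_nonzeroI:
  fixes A :: "real^'n^'n"
  assumes "\<And>z. A *v z = 0 \<Longrightarrow> z = 0"
  shows "det A \<noteq> 0"
  using assms matrix_left_invertible_ker[of A] invertible_left_inverse[of A] invertible_det_nz[of A]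
  by blast

lemma det_gram_index_cone_nonzero:
  assumes "D \<in> index_cone (cubic_form F)"
  shows "det (\<chi> i j. polar3 (cubic_form F) D (axis i 1) (axis j 1)) \<noteq> 0" (is "det ?M \<noteq> 0")
proof -
  let ?f = "cubic_form F"
  let ?T = "polar3 ?f"
  have "z = 0" if z: "?M *v z = 0" for z
  proof (rule index_cone_nondegenerate[OF assms])
    have "?T (axis i 1) D z = (?M *v z) $ i" for i
      using polar3_cubic_form_expand[of F z "axis i 1" D]
      by (simp add: matrix_vector_mult_def mult.commute polar3_commute)
    then have "?T (axis i 1) D z = 0" for i using z by simp
    then have "?T w D z = 0" for w
      using polar3_cubic_form_expand[of F w D z] by simp
    then show "?T D z w = 0" for w using polar3_commute[of ?f] by metis
  qed
  then show ?thesis by (rule det_nonzeroI)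
qed

text \<open>
  Take an orthogonal basis \<open>u, v, w\<close> at a point \<open>D0\<close> of the cone and apply the Gram-Schmidt process to
  it with respect to the quadratic form of a nearby point \<open>D\<close>. The result depends continuously on \<open>D\<close>
  and is \<open>u, v, w\<close> itself at \<open>D0\<close>, so that the three signs persist.
\<close>

lemma open_index_cone: "open (index_cone (cubic_form F))"
proof (subst open_subopen, rule ballI)
  let ?T = "polar3 (cubic_form F)"
  fix D0 assume D0: "D0 \<in> index_cone (cubic_form F)"
  obtain u v w where "span {u, v, w} = UNIV" and pw: "pairwise (\<lambda>x y. ?T D0 x y = 0) {u, v, w}"
    and ne: "u \<noteq> v" "u \<noteq> w" "v \<noteq> w" and signs: "?T D0 u u > 0" "?T D0 v v < 0" "?T D0 w w < 0"
  proof -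
    have "has_signature (?T D0) 1 2" using D0 by (simp add: index_cone_def)
    then show thesis using that by (rule has_signature_1_2E)
  qed
  have o: "?T D0 u v = 0" "?T D0 u w = 0" "?T D0 v w = 0"
    using pw ne by (auto simp: pairwise_insert)
  define v' where "v' D = v - (?T D u v / ?T D u u) *\<^sub>R u" for D
  define w' where "w' D = w - (?T D u w / ?T D u u) *\<^sub>R u - (?T D (v' D) w / ?T D (v' D) (v' D)) *\<^sub>R v' D" for D
  have at0: "v' D0 = v" "w' D0 = w" by (simp_all add: v'_def w'_def o)
  have cv: "isCont v' D0"
    unfolding v'_def using signs by (intro continuous_intros isCont_polar3) auto
  have cw: "isCont w' D0"
    unfolding w'_def using signs at0 by (intro continuous_intros isCont_polar3 cv) auto
  have pos: "\<forall>\<^sub>F D in nhds D0. f D > 0" if "isCont f D0" "f D0 > 0" for f :: "real^3 \<Rightarrow> real"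
    using that order_tendstoD(1)[of f "f D0" "nhds D0" 0] tendsto_at_iff_tendsto_nhds[of f D0]
    by (simp add: isCont_def)
  have neg: "\<forall>\<^sub>F D in nhds D0. f D < 0" if "isCont f D0" "f D0 < 0" for f :: "real^3 \<Rightarrow> real"
    using that order_tendstoD(2)[of f "f D0" "nhds D0" 0] tendsto_at_iff_tendsto_nhds[of f D0]
    by (simp add: isCont_def)
  have "\<forall>\<^sub>F D in nhds D0. ?T D D D > 0 \<and> ?T D u u > 0 \<and> ?T D (v' D) (v' D) < 0 \<and> ?T D (w' D) (w' D) < 0"
    using D0 signs
    by (intro eventually_conj pos neg isCont_polar3 cv cw continuous_intros)
      (simp_all add: at0 index_cone_def polar3_diagonal)
  moreover have "D \<in> index_cone (cubic_form F)"
    if s: "?T D D D > 0" "?T D u u > 0" "?T D (v' D) (v' D) < 0" "?T D (w' D) (w' D) < 0" for D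
  proof -
    have 1: "?T D u (v' D) = 0"
      using s by (simp add: v'_def polar3_simps linear_diff[OF polar3_cubic_form_linear(3)])
    have 2: "?T D u (w' D) = 0"
      using s 1 by (simp add: w'_def polar3_simps linear_diff[OF polar3_cubic_form_linear(3)])
    have 3: "?T D (v' D) u = 0" using 1 polar3_commute by metis
    have "?T D (v' D) (w' D) = 0"
      using s 3 by (simp add: w'_def polar3_simps linear_diff[OF polar3_cubic_form_linear(3)])
    then show ?thesis
      using has_signature_1_2I[of "?T D", OF polar3_cubic_form_linear(2) polar3_commute(2) 1 2] s
      by (simp add: index_cone_def polar3_diagonal)
  qed
  ultimately show "\<exists>S. open S \<and> D0 \<in> S \<and> S \<subseteq> index_cone (cubic_form F)"
    unfolding eventually_nhds by blast
qed

section \<open>The curvature of a level surface in a chart\<close>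

definition frame :: "(real^2 \<Rightarrow> real^3) \<Rightarrow> real^2 \<Rightarrow> real^3^3" where
  "frame \<phi> x = transpose (vector [\<phi> x, pd 1 \<phi> x, pd 2 \<phi> x])"

lemma column_frame [simp]:
  "column 1 (frame \<phi> x) = \<phi> x" "column 2 (frame \<phi> x) = pd 1 \<phi> x" "column 3 (frame \<phi> x) = pd 2 \<phi> x"
  by (simp_all add: frame_def vec_eq_iff column_def transpose_def)

text \<open>
  A smooth map into the surface \<open>F = 1\<close>. It is an immersion where \<open>\<phi>, \<phi>\<^sub>1, \<phi>\<^sub>2\<close> is a basis.
\<close>

locale level_chart =
  fixes F :: ternary_cubic and U :: "(real^2) set" and \<phi> :: "real^2 \<Rightarrow> real^3"
  assumes U: "open U" and \<phi>: "smooth_on \<phi> U"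
    and level: "\<And>y. y \<in> U \<Longrightarrow> cubic_form F (\<phi> y) = 1"
begin

abbreviation (input) "T \<equiv> polar3 (cubic_form F)"
abbreviation (input) "g \<equiv> pullback_metric (index_metric (cubic_form F)) \<phi>"

lemma chart_differentiable:
  assumes "x \<in> U"
  shows "\<phi> differentiable at x" "pd i \<phi> differentiable at x" "pd i (pd j \<phi>) differentiable at x"
  using smooth_on_differentiable[OF _ U assms] smooth_on_pd \<phi> by blast+

lemma chart_metric: "g y $ i $ j = - T (\<phi> y) (pd i \<phi> y) (pd j \<phi> y)"
  by (simp add: pullback_metric_def index_metric_def)

lemma chart_tangent:
  assumes "y \<in> U"
  shows "T (\<phi> y) (\<phi> y) (pd i \<phi> y) = 0"
proof -
  have "0 = pd i (\<lambda>y. T (\<phi> y) (\<phi> y) (\<phi> y)) y"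
    using pd_cong_open[OF U assms, of "\<lambda>_. 1" "\<lambda>y. T (\<phi> y) (\<phi> y) (\<phi> y)" i] level
    by (simp add: polar3_diagonal pd_const)
  also have "\<dots> = 3 * T (\<phi> y) (\<phi> y) (pd i \<phi> y)"
    by (simp add: pd_polar3 chart_differentiable assms polar3_commute[of _ "pd i \<phi> y" "\<phi> y"] polar3_commute(2)[of _ "\<phi> y" "pd i \<phi> y" "\<phi> y"])
  finally show ?thesis by simp
qed

lemma chart_second_normal:
  assumes "y \<in> U"
  shows "T (\<phi> y) (\<phi> y) (pd i (pd j \<phi>) y) = 2 * g y $ i $ j"
proof -
  have "0 = pd i (\<lambda>y. T (\<phi> y) (\<phi> y) (pd j \<phi> y)) y"
    using pd_cong_open[OF U assms, of "\<lambda>_. 0" "\<lambda>y. T (\<phi> y) (\<phi> y) (pd j \<phi> y)" i] chart_tangent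
    by (simp add: pd_const)
  also have "\<dots> = T (\<phi> y) (\<phi> y) (pd i (pd j \<phi>) y) + 2 * T (\<phi> y) (pd i \<phi> y) (pd j \<phi> y)"
    by (simp add: pd_polar3 chart_differentiable assms polar3_commute[of _ "pd i \<phi> y" "\<phi> y"])
  finally show ?thesis by (simp add: chart_metric)
qed

text \<open>
  Differentiating \<open>g\<^sub>j\<^sub>l = - T(\<phi>, \<phi>\<^sub>j, \<phi>\<^sub>l)\<close> in direction \<open>i\<close> produces \<open>- C\<^sub>i\<^sub>j\<^sub>l\<close> and two terms with a
  second derivative of \<open>\<phi>\<close>. In the alternating sum of the three derivatives one copy of \<open>C\<close> and,
  by the symmetry of \<open>\<phi>\<^sub>i\<^sub>j\<close>, two equal terms survive.
\<close>

lemma chart_christoffel_lower: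
  assumes "y \<in> U"
  shows "christoffel_lower g i j l y =
    - T (\<phi> y) (pd l \<phi> y) (pd i (pd j \<phi>) y) + (- 1 / 2) * T (pd i \<phi> y) (pd j \<phi> y) (pd l \<phi> y)"
proof -
  have pdg: "pd i (\<lambda>y. g y $ j $ l) y = - (T (pd i \<phi> y) (pd j \<phi> y) (pd l \<phi> y)
     + T (\<phi> y) (pd l \<phi> y) (pd i (pd j \<phi>) y) + T (\<phi> y) (pd j \<phi> y) (pd i (pd l \<phi>) y))" for i j l
    using pd_cmult[OF differentiable_polar3[OF chart_differentiable(1,2,2)], OF assms assms assms, of i "-1" F j l]
    by (simp add: chart_metric pd_polar3 chart_differentiable assms
        polar3_commute(2)[of _ "\<phi> y" "pd l \<phi> y"])
  have sym: "pd i (pd j \<phi>) y = pd j (pd i \<phi>) y" for i j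
    by (rule pd_commute[OF \<phi> U assms])
  have C: "T (pd i \<phi> y) (pd j \<phi> y) (pd l \<phi> y) = T (pd j \<phi> y) (pd i \<phi> y) (pd l \<phi> y)"
    "T (pd i \<phi> y) (pd j \<phi> y) (pd l \<phi> y) = T (pd l \<phi> y) (pd i \<phi> y) (pd j \<phi> y)"
    by (metis polar3_commute)+
  show ?thesis
    unfolding christoffel_lower_def pdg sym[of j i] sym[of l i] sym[of l j] C[symmetric]
    by (simp add: field_simps)
qed

lemma chart_pd_christoffel_lower:
  assumes "x \<in> U"
  shows "christoffel_lower g i j l differentiable at x"
    and "pd k (christoffel_lower g i j l) x =
    - (T (pd k \<phi> x) (pd l \<phi> x) (pd i (pd j \<phi>) x) + T (\<phi> x) (pd k (pd l \<phi>) x) (pd i (pd j \<phi>) x)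
       + T (\<phi> x) (pd l \<phi> x) (pd k (pd i (pd j \<phi>)) x))
    - (T (pd k (pd i \<phi>) x) (pd j \<phi> x) (pd l \<phi> x) + T (pd i \<phi> x) (pd k (pd j \<phi>) x) (pd l \<phi> x)
       + T (pd i \<phi> x) (pd j \<phi> x) (pd k (pd l \<phi>) x)) / 2"
proof -
  let ?a = "\<lambda>y. T (\<phi> y) (pd l \<phi> y) (pd i (pd j \<phi>) y)"
  let ?b = "\<lambda>y. T (pd i \<phi> y) (pd j \<phi> y) (pd l \<phi> y)"
  have da: "?a differentiable at x" "?b differentiable at x"
    by (intro differentiable_polar3 chart_differentiable assms)+
  have m: "(\<lambda>y. (- 1) * ?a y) differentiable at x" "(\<lambda>y. (- 1 / 2) * ?b y) differentiable at x"
    by (rule differentiable_mult[OF differentiable_const da(1)]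
        differentiable_mult[OF differentiable_const da(2)])+
  then have d: "(\<lambda>y. (- 1) * ?a y + (- 1 / 2) * ?b y) differentiable at x"
    by (rule differentiable_add)
  have eq: "(- 1) * ?a y + (- 1 / 2) * ?b y = christoffel_lower g i j l y" if "y \<in> U" for y
    using chart_christoffel_lower[OF that] by simp
  show "christoffel_lower g i j l differentiable at x"
    using differentiable_transform_open[OF U assms eq d] .
  have "pd k (christoffel_lower g i j l) x = pd k (\<lambda>y. (- 1) * ?a y + (- 1 / 2) * ?b y) x"
    using pd_cong_open[OF U assms eq d] by simp
  also have "\<dots> = (- 1) * pd k ?a x + (- 1 / 2) * pd k ?b x"
    unfolding pd_add[OF m] pd_cmult[OF da(1)] pd_cmult[OF da(2)] by (rule refl)
  finally show "pd k (christoffel_lower g i j l) x =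
    - (T (pd k \<phi> x) (pd l \<phi> x) (pd i (pd j \<phi>) x) + T (\<phi> x) (pd k (pd l \<phi>) x) (pd i (pd j \<phi>) x)
       + T (\<phi> x) (pd l \<phi> x) (pd k (pd i (pd j \<phi>)) x))
    - (T (pd k (pd i \<phi>) x) (pd j \<phi> x) (pd l \<phi> x) + T (pd i \<phi> x) (pd k (pd j \<phi>) x) (pd l \<phi> x)
       + T (pd i \<phi> x) (pd j \<phi> x) (pd k (pd l \<phi>) x)) / 2"
    by (simp add: pd_polar3 chart_differentiable assms)
qed

text \<open>
  The Gauss formula of the surface with \<open>\<phi>\<close> itself as transversal vector field. The coefficient of \<open>\<phi>\<close>
  is found by applying \<open>T(\<phi>, \<phi>, \<cdot>)\<close>, which is 1 on \<open>\<phi>\<close> and 0 on tangent vectors.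
\<close>

lemma chart_gauss_formula:
  assumes x: "x \<in> U" and det: "det (frame \<phi> x) \<noteq> 0"
  obtains A :: "2 \<Rightarrow> 2 \<Rightarrow> 2 \<Rightarrow> real" where
    "\<And>i j. pd i (pd j \<phi>) x = (2 * g x $ i $ j) *\<^sub>R \<phi> x + A 1 i j *\<^sub>R pd 1 \<phi> x + A 2 i j *\<^sub>R pd 2 \<phi> x"
proof -
  have "\<exists>a b. pd i (pd j \<phi>) x = (2 * g x $ i $ j) *\<^sub>R \<phi> x + a *\<^sub>R pd 1 \<phi> x + b *\<^sub>R pd 2 \<phi> x" for i j
  proof -
    obtain B where "frame \<phi> x ** B = mat 1"
      using det unfolding invertible_det_nz[symmetric] invertible_def by blast
    then have "frame \<phi> x *v (B *v pd i (pd j \<phi>) x) = pd i (pd j \<phi>) x"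
      by (simp add: matrix_vector_mul_assoc)
    then obtain z where "frame \<phi> x *v z = pd i (pd j \<phi>) x" by blast
    then have z: "pd i (pd j \<phi>) x = z$1 *\<^sub>R \<phi> x + z$2 *\<^sub>R pd 1 \<phi> x + z$3 *\<^sub>R pd 2 \<phi> x"
      by (simp add: matrix_vector_mult_columns_3)
    have "2 * g x $ i $ j = T (\<phi> x) (\<phi> x) (pd i (pd j \<phi>) x)"
      using chart_second_normal[OF x] by simp
    also have "\<dots> = z$1"
      unfolding z by (simp add: polar3_simps chart_tangent[OF x] polar3_diagonal level[OF x])
    finally show ?thesis using z by metis
  qed
  then have "\<exists>c. pd i (pd j \<phi>) x = (2 * g x $ i $ j) *\<^sub>R \<phi> x + fst c *\<^sub>R pd 1 \<phi> x + snd c *\<^sub>R pd 2 \<phi> x" for i j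
    by simp
  then obtain c where c: "pd i (pd j \<phi>) x
      = (2 * g x $ i $ j) *\<^sub>R \<phi> x + fst (c i j) *\<^sub>R pd 1 \<phi> x + snd (c i j) *\<^sub>R pd 2 \<phi> x" for i j
    by metis
  show ?thesis
    by (rule that[of "\<lambda>k i j. if k = 1 then fst (c i j) else snd (c i j)"]) (simp add: c)
qed

text \<open>
  Let \<open>D\<close> be the difference of the connection \<open>A\<close> of the Gauss formula and the Levi-Civita connection
  \<open>G\<close>. Comparing the two expressions for the Christoffel symbols of the first kind shows that lowering the
  index of \<open>D\<close> gives half the cubic form \<open>C\<close>. Substituting \<open>A = G + D\<close> into the curvature formula, all
  terms containing \<open>G\<close> cancel; the terms quadratic in \<open>g\<close> add up to \<open>- 2 det g\<close>, and the terms
  quadratic in \<open>D\<close> combine with those in \<open>C D\<close>. Cramer's rule for \<open>D\<close> then gives the Aronhold invariant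
  in the adapted basis, whose leading part \<open>(p r - q\<^sup>2)\<^sup>2\<close> accounts for the change from \<open>- 2\<close> to
  \<open>- 9/4\<close>.
\<close>

lemma chart_gauss_curvature:
  assumes x: "x \<in> U" and frame: "det (frame \<phi> x) \<noteq> 0" and det: "\<And>y. y \<in> U \<Longrightarrow> det (g y) \<noteq> 0"
  shows "gauss_curvature g x =
    - (9/4) + aronhold_S (cubic_subst F (frame \<phi> x)) / (4 * (det (g x))\<^sup>2)"
proof -
  obtain A :: "2 \<Rightarrow> 2 \<Rightarrow> 2 \<Rightarrow> real" where
    A: "\<And>i j. pd i (pd j \<phi>) x = (2 * g x $ i $ j) *\<^sub>R \<phi> x + A 1 i j *\<^sub>R pd 1 \<phi> x + A 2 i j *\<^sub>R pd 2 \<phi> x"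
    using chart_gauss_formula[OF x frame] by metis
  define p q r where "p = g x $ 1 $ 1" and "q = g x $ 1 $ 2" and "r = g x $ 2 $ 2"
  define a30 a21 a12 a03 where "a30 = T (pd 1 \<phi> x) (pd 1 \<phi> x) (pd 1 \<phi> x)"
    and "a21 = T (pd 1 \<phi> x) (pd 1 \<phi> x) (pd 2 \<phi> x)" and "a12 = T (pd 1 \<phi> x) (pd 2 \<phi> x) (pd 2 \<phi> x)"
    and "a03 = T (pd 2 \<phi> x) (pd 2 \<phi> x) (pd 2 \<phi> x)"
  define e0 e1 e2 where "e0 = \<phi> x" and "e1 = pd 1 \<phi> x" and "e2 = pd 2 \<phi> x"
  have T: "T e0 e0 e0 = 1" "T e0 e0 e1 = 0" "T e0 e1 e0 = 0" "T e1 e0 e0 = 0"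
    "T e0 e0 e2 = 0" "T e0 e2 e0 = 0" "T e2 e0 e0 = 0"
    "T e0 e1 e1 = - p" "T e1 e0 e1 = - p" "T e1 e1 e0 = - p"
    "T e0 e1 e2 = - q" "T e0 e2 e1 = - q" "T e1 e0 e2 = - q" "T e2 e0 e1 = - q" "T e1 e2 e0 = - q" "T e2 e1 e0 = - q"
    "T e0 e2 e2 = - r" "T e2 e0 e2 = - r" "T e2 e2 e0 = - r"
    "T e1 e1 e1 = a30" "T e1 e1 e2 = a21" "T e1 e2 e1 = a21" "T e2 e1 e1 = a21"
    "T e1 e2 e2 = a12" "T e2 e1 e2 = a12" "T e2 e2 e1 = a12" "T e2 e2 e2 = a03"
    using chart_tangent[OF x] level[OF x]
    by (simp_all add: e0_def e1_def e2_def p_def q_def r_def chart_metric a30_def a21_def a12_def a03_def polar3_diagonal)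
      (metis polar3_commute)+
  have S: "aronhold_S (cubic_subst F (frame \<phi> x)) = (p * r - q\<^sup>2)\<^sup>2
      + (p * (a12\<^sup>2 - a21 * a03) + q * (a30 * a03 - a21 * a12) + r * (a21\<^sup>2 - a30 * a12))"
    using aronhold_S_adapted[of 1 a30 a03 p a21 r a12 q]
    by (simp add: cubic_subst_def Let_def T flip: e0_def e1_def e2_def)
  have q': "g x $ 2 $ 1 = q"
    by (simp add: q_def chart_metric) (metis polar3_commute)
  have detg: "det (g x) = p * r - q\<^sup>2"
    by (simp add: det_2 p_def r_def q' power2_eq_square flip: q_def)
  define G where "G k i j = christoffel g k i j x" for k i j
  have low: "christoffel_lower g i j 1 x = p * G 1 i j + q * G 2 i j"
    "christoffel_lower g i j 2 x = q * G 1 i j + r * G 2 i j" for i j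
    using christoffel_lower_eq[of g x 1 i j, OF det[OF x]]
      christoffel_lower_eq[of g x 2 i j, OF det[OF x]]
    by (simp_all add: sum_2 G_def p_def r_def q' flip: q_def)
  \<comment> \<open>the third derivatives of \<open>\<phi>\<close> that cancel in the curvature formula\<close>
  have third: "pd 1 (pd 2 (pd 2 \<phi>)) x = pd 2 (pd 1 (pd 2 \<phi>)) x"
    by (rule pd_commute[OF smooth_on_pd[OF \<phi>] U x])
  have second: "pd 2 (pd 1 \<phi>) x = pd 1 (pd 2 \<phi>) x"
    by (rule pd_commute[OF \<phi> U x])
  have K: "gauss_curvature g x * det (g x) =
    pd 1 (christoffel_lower g 2 2 1) x - pd 2 (christoffel_lower g 1 2 1) x
    - (\<Sum>l\<in>UNIV. christoffel_lower g 1 1 l x * christoffel g l 2 2 x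
               - christoffel_lower g 1 2 l x * christoffel g l 1 2 x)"
  proof (rule gauss_curvature_lower[OF U x])
    show "g y $ i $ j = g y $ j $ i" for y i j
      by (simp add: chart_metric) (metis polar3_commute)
    show "(\<lambda>y. g y $ i $ j) differentiable at x" for i j
      unfolding chart_metric
      by (intro differentiable_minus differentiable_polar3 chart_differentiable x)
  qed (use det chart_pd_christoffel_lower(1)[OF x] in auto)
  define D where "D k i j = A k i j - G k i j" for k i j
  have AD: "A k i j = G k i j + D k i j" for k i j by (simp add: D_def)
  have lowA: "christoffel_lower g i j 1 x = p * A 1 i j + q * A 2 i j - T (pd i \<phi> x) (pd j \<phi> x) e1 / 2"
    "christoffel_lower g i j 2 x = q * A 1 i j + r * A 2 i j - T (pd i \<phi> x) (pd j \<phi> x) e2 / 2" for i j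
    unfolding chart_christoffel_lower[OF x] A e0_def[symmetric] e1_def[symmetric] e2_def[symmetric]
    by (simp_all add: polar3_simps T)
  have D: "p * D 1 i j + q * D 2 i j = T (pd i \<phi> x) (pd j \<phi> x) e1 / 2"
    "q * D 1 i j + r * D 2 i j = T (pd i \<phi> x) (pd j \<phi> x) e2 / 2" for i j
    using low[of i j] lowA[of i j] by (simp_all add: D_def algebra_simps)
  \<comment> \<open>the relation between \<open>D\<close> and \<open>C\<close>, multiplied by arbitrary factors: in this form its instances
    turn the next identity into a linear one in the monomials\<close>
  have DG: "p * (s * D 1 i j) + q * (s * D 2 i j) + q * (t * D 1 i j) + r * (t * D 2 i j)
      = (s * T (pd i \<phi> x) (pd j \<phi> x) e1 + t * T (pd i \<phi> x) (pd j \<phi> x) e2) / 2" for s t i j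
    using D[of i j] by algebra
  have K1: "gauss_curvature g x * det (g x) = - 2 * det (g x)
      - (a30 * D 1 2 2 + a21 * D 2 2 2 - a21 * D 1 1 2 - a12 * D 2 1 2) / 2"
    unfolding K chart_pd_christoffel_lower(2)[OF x] second third sum_2 low G_def[symmetric]
    unfolding A e0_def[symmetric] e1_def[symmetric] e2_def[symmetric]
    unfolding AD
    apply (simp add: polar3_simps T detg flip: p_def q_def r_def)
    using DG[of "G 1 1 1" 2 2 "G 2 1 1"] DG[of "G 1 2 2" 1 1 "G 2 2 2"]
      DG[of "G 1 1 2" 1 2 "G 2 1 2"] DG[of "D 1 1 1" 2 2 "D 2 1 1"] DG[of "D 1 2 2" 1 1 "D 2 2 2"]
      DG[of "D 1 1 2" 1 2 "D 2 1 2"]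
    apply (simp add: T flip: e1_def e2_def)
    apply (simp add: algebra_simps add_divide_distrib diff_divide_distrib power2_eq_square)
    done
  have "det (g x) * (a30 * D 1 2 2 + a21 * D 2 2 2 - a21 * D 1 1 2 - a12 * D 2 1 2)
     = (a30 * (r * a12 - q * a03) + a21 * (p * a03 - q * a12) - a21 * (r * a21 - q * a12) - a12 * (p * a12 - q * a21)) / 2"
  proof -
    have "det (g x) * D 1 i j = (r * T (pd i \<phi> x) (pd j \<phi> x) e1 - q * T (pd i \<phi> x) (pd j \<phi> x) e2) / 2"
      "det (g x) * D 2 i j = (p * T (pd i \<phi> x) (pd j \<phi> x) e2 - q * T (pd i \<phi> x) (pd j \<phi> x) e1) / 2" for i j
      using D[of i j] unfolding detg by algebra+
    note this[of 1 2] this[of 2 2]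
    then show ?thesis unfolding e1_def[symmetric] e2_def[symmetric] T by algebra
  qed
  then have "gauss_curvature g x * (det (g x))\<^sup>2 = - (9/4) * (det (g x))\<^sup>2
      + aronhold_S (cubic_subst F (frame \<phi> x)) / 4"
    using K1 unfolding S detg by algebra
  then show ?thesis
    using det[OF x] by (simp add: field_simps)
qed

text \<open>
  In a vanishing combination of \<open>\<phi>, \<phi>\<^sub>1, \<phi>\<^sub>2\<close> the coefficient of \<open>\<phi>\<close> is zero, as \<open>T(\<phi>, \<phi>, \<cdot>)\<close> shows, and the
  rest is a value of the injective derivative of \<open>\<phi>\<close>.
\<close>

lemma det_frame_nonzero:
  assumes x: "x \<in> U" and inj: "inj (frechet_derivative \<phi> (at x))"
  shows "det (frame \<phi> x) \<noteq> 0"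
proof -
  have "z = 0" if z: "frame \<phi> x *v z = 0" for z
  proof -
    have z': "z$1 *\<^sub>R \<phi> x + z$2 *\<^sub>R pd 1 \<phi> x + z$3 *\<^sub>R pd 2 \<phi> x = 0"
      using z by (simp add: matrix_vector_mult_columns_3)
    have "z$1 = T (\<phi> x) (\<phi> x) (z$1 *\<^sub>R \<phi> x + z$2 *\<^sub>R pd 1 \<phi> x + z$3 *\<^sub>R pd 2 \<phi> x)"
      by (simp add: polar3_simps chart_tangent[OF x] polar3_diagonal level[OF x])
    then have z1: "z$1 = 0" using z' by (simp add: linear_0[OF polar3_cubic_form_linear(3)])
    have lin: "linear (frechet_derivative \<phi> (at x))"
      using chart_differentiable(1)[OF x] linear_frechet_derivative by blast
    have "frechet_derivative \<phi> (at x) (z$2 *\<^sub>R axis 1 1 + z$3 *\<^sub>R axis 2 1) = 0"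
      using z' z1 by (simp add: pd_def linear_add[OF lin] linear_scale[OF lin])
    then have "z$2 *\<^sub>R axis 1 1 + z$3 *\<^sub>R axis 2 1 = (0 :: real^2)"
      using inj lin by (metis linear_injective_0)
    then have "z$2 = 0" "z$3 = 0" by (simp_all add: vec_eq_iff forall_2 axis_def)
    then show ?thesis using z1 by (simp add: vec_eq_iff forall_3)
  qed
  then show ?thesis by (rule det_nonzeroI)
qed

text \<open>
  Both sides compute the Gram determinant of \<open>T(\<phi>, \<cdot>, \<cdot>)\<close> in the frame. It is block diagonal there,
  with blocks \<open>1\<close> and \<open>- g\<close>, and the sign disappears in the determinant of a two-by-two block.
\<close>

lemma det_metric_eq_hessian:
  assumes x: "x \<in> U"
  shows "216 * det (g x)
    = (det (frame \<phi> x))\<^sup>2 * hessian_det (cubic_form F) (\<phi> x)"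
proof -
  have "T (\<phi> x) (pd i \<phi> x) (\<phi> x) = 0" for i
    using chart_tangent[OF x] polar3_commute by metis
  then have "det (\<chi> i j. T (\<phi> x) (column i (frame \<phi> x)) (column j (frame \<phi> x))) = det (g x)"
    using chart_tangent[OF x] level[OF x]
    by (simp add: det_3 det_2 chart_metric polar3_diagonal)
  then show ?thesis
    using det_gram_polar3[of F "\<phi> x" "frame \<phi> x"] by (simp add: hessian_det_cubic_form)
qed

end

text \<open>
  Since \<open>det g = (det M)\<^sup>2 H / 6\<^sup>3\<close> for the frame \<open>M\<close>, and \<open>S\<close> scales by \<open>(det M)\<^sup>4\<close>, the frame drops out of
  \<open>S / (det g)\<^sup>2\<close>. The Hessian is nonzero because the quadratic form \<open>T(\<phi>, \<cdot>, \<cdot>)\<close> is nondegenerate on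
  the index cone.
\<close>

lemma gauss_curvature_surface_chart:
  assumes chart: "surface_chart (index_level (cubic_form F)) U \<phi>" and x: "x \<in> U"
  shows "gauss_curvature (pullback_metric (index_metric (cubic_form F)) \<phi>) x
    = - (9/4) + 6^6 * aronhold_S F / (4 * (hessian_det (cubic_form F) (\<phi> x))\<^sup>2)"
proof -
  let ?g = "pullback_metric (index_metric (cubic_form F)) \<phi>"
  let ?H = "\<lambda>y. hessian_det (cubic_form F) (\<phi> y)"
  have U: "open U" "smooth_on \<phi> U" and inj: "\<And>y. y \<in> U \<Longrightarrow> inj (frechet_derivative \<phi> (at y))"
    and img: "\<phi> ` U \<subseteq> index_level (cubic_form F)"
    using chart openin_imp_subset unfolding surface_chart_def by blast+
  have lc: "level_chart F U \<phi>"
    using U img by unfold_locales (auto simp: index_level_def)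
  have H: "?H y \<noteq> 0" if "y \<in> U" for y
    using img that det_gram_index_cone_nonzero[of "\<phi> y" F]
    by (auto simp: hessian_det_cubic_form index_level_def)
  have A: "det (frame \<phi> y) \<noteq> 0" if "y \<in> U" for y
    using level_chart.det_frame_nonzero[OF lc that inj[OF that]] .
  have g: "det (?g y) = (det (frame \<phi> y))\<^sup>2 * ?H y / 216" if "y \<in> U" for y
    using level_chart.det_metric_eq_hessian[OF lc that] by simp
  have "gauss_curvature ?g x = - (9/4) + aronhold_S (cubic_subst F (frame \<phi> x)) / (4 * (det (?g x))\<^sup>2)"
    by (rule level_chart.chart_gauss_curvature[OF lc x A[OF x]]) (simp add: g A H)
  also have "aronhold_S (cubic_subst F (frame \<phi> x)) / (4 * (det (?g x))\<^sup>2)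
      = 6^6 * aronhold_S F / (4 * (?H x)\<^sup>2)"
    using A[OF x] H[OF x]
    by (simp add: aronhold_S_subst g[OF x] field_simps)
  finally show ?thesis .
qed

section \<open>Radial charts of the index surface\<close>

text \<open>
  A suitable multiple of an orthogonal matrix.
\<close>

lemma exists_invertible_matrix_column:
  fixes p :: "real^'n"
  assumes "p \<noteq> 0"
  obtains A B :: "real^'n^'n" where "A ** B = mat 1" "B ** A = mat 1" "A *v axis k 1 = p"
proof -
  obtain Q :: "real^'n^'n" where Q: "orthogonal_matrix Q" "Q *v axis k 1 = p /\<^sub>R norm p"
    using orthogonal_matrix_exists_basis[of "p /\<^sub>R norm p" k] assms by auto
  have "(norm p *\<^sub>R Q) ** (inverse (norm p) *\<^sub>R transpose Q) = mat 1"
    "(inverse (norm p) *\<^sub>R transpose Q) ** (norm p *\<^sub>R Q) = mat 1"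
    using Q(1) assms by (simp_all add: orthogonal_matrix_def matrix_scalar_ac scalar_matrix_assoc[symmetric])
  moreover have "(norm p *\<^sub>R Q) *v axis k 1 = p"
    using Q(2) assms by (simp add: scaleR_matrix_vector_assoc[symmetric])
  ultimately show thesis using that by blast
qed

text \<open>
  Choose linear coordinates, given by \<open>B\<close>, in which \<open>p\<close> is the first unit vector. The chart \<open>\<phi>\<close>
  rescales the points \<open>w\<close> of the affine plane of first coordinate 1 to \<open>F = 1\<close>; its inverse \<open>\<psi>\<close> divides by
  the first coordinate. As the index cone is invariant under positive scaling, the image is the whole part
  of the surface where the first coordinate is positive, which is relatively open.
\<close>

lemma index_level_has_chart:
  assumes p: "p \<in> index_level (cubic_form F)"
  shows "\<exists>U \<phi>. surface_chart (index_level (cubic_form F)) U \<phi> \<and> p \<in> \<phi> ` U"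
proof -
  let ?f = "cubic_form F"
  have "p \<noteq> 0"
    using p cubic_form_scaleR[of F 0 p] by (auto simp: index_level_def)
  then obtain A B :: "real^3^3" where AB: "A ** B = mat 1" "B ** A = mat 1" and A1: "A *v axis 1 1 = p"
    using exists_invertible_matrix_column[of p 1] by metis
  have BA: "B *v (A *v z) = z" "A *v (B *v z) = z" for z
    using AB by (simp_all add: matrix_vector_mul_assoc)
  define J :: "real^2 \<Rightarrow> real^3" where "J x = vector [0, x$1, x$2]" for x
  have J [simp]: "J x $ 1 = 0" "J x $ 2 = x$1" "J x $ 3 = x$2" for x by (simp_all add: J_def)
  have linJ: "linear J"
    by (rule linearI) (simp_all add: vec_eq_iff forall_3)
  define w where "w x = p + A *v J x" for x
  define U where "U = {x. w x \<in> index_cone ?f}"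
  define s where "s x = ?f (w x) powr (- 1 / 3)" for x
  define \<phi> where "\<phi> x = s x *\<^sub>R w x" for x
  define \<psi> :: "real^3 \<Rightarrow> real^2"
    where "\<psi> y = vector [(B *v y)$2 / (B *v y)$1, (B *v y)$3 / (B *v y)$1]" for y
  have Bw: "B *v w x = axis 1 1 + J x" for x
    using BA(1)[of "axis 1 1"] A1 by (simp add: w_def BA matrix_vector_right_distrib)
  have linAJ: "bounded_linear (\<lambda>x. A *v J x)"
    using linear_compose[OF linJ matrix_vector_mul_linear[of A]]
    by (simp add: linear_conv_bounded_linear o_def)
  have wd: "(w has_derivative (\<lambda>v. A *v J v)) (at x)" for x
    unfolding w_def using bounded_linear_imp_has_derivative[OF linAJ]
    by (auto intro!: derivative_eq_intros)
  have "open U"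
  proof -
    have "continuous_on UNIV w"
      using wd has_derivative_continuous by (simp add: continuous_on_eq_continuous_at) blast
    then show ?thesis
      using open_vimage[OF open_index_cone[of F]] unfolding U_def vimage_def by blast
  qed
  have pos: "?f (w x) > 0" if "x \<in> U" for x
    using that by (simp add: U_def index_cone_def)
  have spos: "s x > 0" if "x \<in> U" for x
    using pos[OF that] by (simp add: s_def)
  have s3: "s x ^ 3 * ?f (w x) = 1" if "x \<in> U" for x
  proof -
    have "s x ^ 3 = s x powr 3" using spos[OF that] by simp
    also have "\<dots> = ?f (w x) powr (- 1)" by (simp add: s_def powr_powr)
    finally show ?thesis using pos[OF that] by (simp add: powr_minus)
  qed
  have Cw: "C_k_on k w U" for k
    unfolding w_def using C_k_on_bounded_linear[OF linAJ \<open>open U\<close>]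
    by (intro C_k_on_add C_k_on_const \<open>open U\<close>)
  have Cs: "C_k_on k s U" for k
    unfolding s_def by (intro C_k_on_powr C_k_on_cubic_form Cw \<open>open U\<close> pos)
  have smooth: "smooth_on \<phi> U"
    unfolding smooth_on_def \<phi>_def
    using C_k_on_bilinear[OF bounded_bilinear_scaleR Cs Cw \<open>open U\<close>] by blast
  have level: "\<phi> x \<in> index_level ?f" if "x \<in> U" for x
    using that index_cone_scaleR[of "w x" F "s x"] spos[OF that] s3[OF that]
    by (simp add: index_level_def \<phi>_def U_def cubic_form_scaleR)
  have B\<phi>: "B *v \<phi> x = s x *\<^sub>R (axis 1 1 + J x)" for x
    by (simp add: \<phi>_def matrix_vector_mult_scaleR Bw)
  have \<psi>\<phi>: "\<psi> (\<phi> x) = x" if "x \<in> U" for x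
    using spos[OF that] by (simp add: \<psi>_def B\<phi> vec_eq_iff forall_2 axis_def)
  \<comment> \<open>on the image, \<open>w (\<psi> y) = y / c\<close> and \<open>F (y / c) = c powr (- 3)\<close>, where \<open>c\<close> is the first coordinate of \<open>y\<close>\<close>
  have image: "\<phi> ` U = index_level ?f \<inter> {y. (B *v y)$1 > 0}"
  proof (intro equalityI subsetI)
    fix y assume "y \<in> \<phi> ` U"
    then show "y \<in> index_level ?f \<inter> {y. (B *v y)$1 > 0}"
      using level spos by (auto simp: B\<phi> axis_def)
  next
    fix y assume y: "y \<in> index_level ?f \<inter> {y. (B *v y)$1 > 0}"
    define c where "c = (B *v y)$1"
    have c: "c > 0" using y by (simp add: c_def)
    have "B *v w (\<psi> y) = inverse c *\<^sub>R (B *v y)"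
      using c by (simp add: Bw vec_eq_iff forall_3 \<psi>_def axis_def c_def divide_inverse mult.commute)
    then have wy: "w (\<psi> y) = inverse c *\<^sub>R y"
      using BA(2) by (metis matrix_vector_mult_scaleR)
    have "\<psi> y \<in> U"
      using y c index_cone_scaleR[of y F "inverse c"] by (simp add: U_def wy index_level_def)
    moreover have "\<phi> (\<psi> y) = y"
    proof -
      have "?f (w (\<psi> y)) = c powr (- 3)"
        using y c by (simp add: wy cubic_form_scaleR index_level_def powr_minus power_inverse)
      then have "s (\<psi> y) = c"
        using c by (simp add: s_def powr_powr)
      then show ?thesis using c by (simp add: \<phi>_def wy)
    qed
    ultimately show "y \<in> \<phi> ` U" by force
  qed
  have cont\<psi>: "continuous_on (\<phi> ` U) \<psi>"
  proof -
    have cB: "continuous_on (\<phi> ` U) (\<lambda>y. (B *v y)$i)" for i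
      by (intro continuous_intros linear_continuous_on matrix_vector_mul_bounded_linear)
    have "\<psi> = (\<lambda>y. ((B *v y)$2 / (B *v y)$1) *\<^sub>R axis 1 1 + ((B *v y)$3 / (B *v y)$1) *\<^sub>R axis 2 1)"
      by (simp add: fun_eq_iff \<psi>_def vec_eq_iff forall_2 axis_def)
    then show ?thesis
      using image by (auto intro!: continuous_intros cB)
  qed
  have "homeomorphism U (\<phi> ` U) \<phi> \<psi>"
    using smooth cont\<psi> \<psi>\<phi> unfolding homeomorphism_def smooth_on_def
    by (auto simp: image_image) (metis C_k_on.simps(1))
  moreover have "openin (top_of_set (index_level ?f)) (\<phi> ` U)"
  proof -
    have "open {y. (B *v y)$1 > 0}"
      by (intro open_Collect_less continuous_intros linear_continuous_on matrix_vector_mul_bounded_linear)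
    then show ?thesis unfolding image by (rule openin_open_Int)
  qed
  moreover have "inj (frechet_derivative \<phi> (at x))" if x: "x \<in> U" for x
  proof -
    have "C_k_on (Suc 0) s U" by (rule Cs)
    note sd = C_k_on_Suc_derivative[OF this \<open>open U\<close> x]
    let ?s' = "frechet_derivative s (at x)"
    have d: "frechet_derivative \<phi> (at x) = (\<lambda>v. s x *\<^sub>R (A *v J v) + ?s' v *\<^sub>R w x)"
      using frechet_derivative_at[OF has_derivative_scaleR[OF sd wd]] unfolding \<phi>_def by simp
    have lin: "linear (frechet_derivative \<phi> (at x))"
      using smooth_on_differentiable[OF smooth \<open>open U\<close> x] linear_frechet_derivative by blast
    have "v = 0" if "frechet_derivative \<phi> (at x) v = 0" for v
    proof -
      have "0 = B *v (s x *\<^sub>R (A *v J v) + ?s' v *\<^sub>R w x)"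
        using that d by simp
      also have "\<dots> = s x *\<^sub>R J v + ?s' v *\<^sub>R (axis 1 1 + J x)"
        by (simp add: matrix_vector_right_distrib matrix_vector_mult_scaleR BA Bw)
      finally have e: "s x *\<^sub>R J v + ?s' v *\<^sub>R (axis 1 1 + J x) = 0" by simp
      have "?s' v = 0" using arg_cong[OF e, of "\<lambda>z. z$1"] by (simp add: axis_def)
      then have "s x *\<^sub>R J v = 0" using e by simp
      then have "J v = 0" using spos[OF x] by simp
      then show "v = 0"
        using arg_cong[OF \<open>J v = 0\<close>, of "\<lambda>z. z$2"] arg_cong[OF \<open>J v = 0\<close>, of "\<lambda>z. z$3"]
        by (simp add: vec_eq_iff forall_2)
    qed
    then show ?thesis using linear_injective_0[OF lin] by blast
  qed
  ultimately have "surface_chart (index_level ?f) U \<phi>"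
    using \<open>open U\<close> smooth unfolding surface_chart_def by blast
  moreover have "p \<in> \<phi> ` U"
    unfolding image using p BA(1)[of "axis 1 1"] A1 by (simp add: axis_def)
  ultimately show ?thesis by blast
qed

section \<open>The curvature in terms of the invariants\<close>

theorem theorem5p1:
  fixes F :: ternary_cubic and D :: "real^3"
  assumes "D \<in> index_cone (cubic_form F)"
  shows "has_gauss_curvature_at
           (index_level (cubic_form F)) (index_metric (cubic_form F))
           (D /\<^sub>R root 3 (cubic_form F D))
           (- (9/4) + 6^6 * aronhold_S F * (cubic_form F D)^2
                      / (4 * (hessian_det (cubic_form F) D)^2))"
proof -
  let ?f = "cubic_form F"
  define c where "c = root 3 (?f D)"
  have fD: "?f D > 0" using assms by (simp add: index_cone_def)
  have c: "c > 0" "c ^ 3 = ?f D" using fD by (simp_all add: c_def)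
  define p where "p = D /\<^sub>R c"
  have D: "D = c *\<^sub>R p" using c by (simp add: p_def)
  have p: "p \<in> index_level ?f"
    using index_cone_scaleR[OF assms, of "inverse c"] c fD
    by (simp add: index_level_def p_def cubic_form_scaleR power_inverse)
  have H: "hessian_det ?f D = c ^ 3 * hessian_det ?f p"
    unfolding hessian_det_cubic_form D by (simp add: polar3_simps det_3 power3_eq_cube) (simp add: algebra_simps)
  have eq: "6^6 * aronhold_S F * (?f D)\<^sup>2 / (4 * (hessian_det ?f D)\<^sup>2)
      = 6^6 * aronhold_S F / (4 * (hessian_det ?f p)\<^sup>2)"
    unfolding H c(2)[symmetric] using c(1) by (simp add: power_mult_distrib)
  show ?thesis
    unfolding has_gauss_curvature_at_def eq c_def[symmetric] p_def[symmetric]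
    using index_level_has_chart[OF p] gauss_curvature_surface_chart by blast
qed

end
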